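(* Fix $k \geq 4$. Let $G_O$ be a graph, let $G_N=(V_N,E_N)$ with positive vertex weights $w$ be obtained from $G_O$ by inserting a graph $G_A=(V_A,E_A)$, let $n=|V_N|$, let $\Delta$ be the maximum degree of $G_N$, and let $OPT(G_O)$ be a minimum-weight $k$-path vertex cover of $G_O$. Let $A_\rho$ be a $\rho$-approximation algorithm ($\rho\ge 1$) for weighted $k$-path vertex cover with running time $T(A_\rho,G_N)$ on $G_N$. Let $b = |V_A|\,\Delta\,(\Delta-1)^{\lceil\frac{k-5}{2}\rceil}$ and assume $(\Delta+1)b \in O(\log n)$. Then there is an algorithm (Wtd-kpath) which, given $(G_O,G_N,OPT(G_O))$ and access to $A_\rho$, outputs a $k$-path vertex cover of $G_N$ of weight at most $(2-\frac{1}{\rho})\, w(OPT(G_N))$, where $OPT(G_N)$ is a minimum-weight $k$-path vertex cover of $G_N$, and runs in time $O(n^{O(1)}\cdot 2^{k(\Delta+1)b}\cdot T(A_\rho,G_N))$.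
   Context: All graphs are finite, simple and undirected. A $k$-path is a simple path containing exactly $k$ vertices; $S\subseteq V(G)$ is a $k$-path vertex cover of $G$ if every $k$-path of $G$ contains a vertex of $S$; its weight is $w(S)=\sum_{v\in S}w(v)$. Inserting a graph $G_A=(V_A,E_A)$ (disjoint from $G_O$) into $G_O=(V_O,E_O)$ via attachment edges $E^a\subseteq V_O\times V_A$ yields $G_N=(V_O\cup V_A, E_O\cup E_A\cup E^a)$. A $\rho$-approximation algorithm for weighted $k$-path vertex cover outputs, on any vertex-weighted graph, a $k$-path vertex cover of weight at most $\rho$ times the minimum. *)

theory Defs
  imports Complex_Main "HOL-Library.Landau_Symbols"
begin

section \<open>Graphs and path vertex covers\<close>

record graph =
  verts :: "nat set"
  edges :: "nat set set"

definition is_graph :: "graph \<Rightarrow> bool" where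
  "is_graph G \<longleftrightarrow> finite (verts G) \<and>
     (\<forall>e\<in>edges G. \<exists>u\<in>verts G. \<exists>v\<in>verts G. u \<noteq> v \<and> e = {u, v})"

definition degree :: "graph \<Rightarrow> nat \<Rightarrow> nat" where
  "degree G v = card {e \<in> edges G. v \<in> e}"

definition max_degree :: "graph \<Rightarrow> nat" where
  "max_degree G = Max (insert 0 (degree G ` verts G))"

definition is_kpath :: "nat \<Rightarrow> graph \<Rightarrow> nat list \<Rightarrow> bool" where
  "is_kpath k G p \<longleftrightarrow> length p = k \<and> distinct p \<and> set p \<subseteq> verts G \<and>
     (\<forall>i. Suc i < k \<longrightarrow> {p ! i, p ! Suc i} \<in> edges G)"

definition kpath_cover :: "nat \<Rightarrow> graph \<Rightarrow> nat set \<Rightarrow> bool" where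
  "kpath_cover k G S \<longleftrightarrow> S \<subseteq> verts G \<and> (\<forall>p. is_kpath k G p \<longrightarrow> set p \<inter> S \<noteq> {})"

definition min_kpath_cover :: "nat \<Rightarrow> graph \<Rightarrow> (nat \<Rightarrow> real) \<Rightarrow> nat set \<Rightarrow> bool" where
  "min_kpath_cover k G w S \<longleftrightarrow> kpath_cover k G S \<and>
     (\<forall>S'. kpath_cover k G S' \<longrightarrow> sum w S \<le> sum w S')"

section \<open>Graph insertion\<close>

record insertion =
  old_graph :: graph
  added_graph :: graph
  attachment :: "(nat \<times> nat) set"
  weight :: "nat \<Rightarrow> real"
  old_opt :: "nat set"

definition new_graph :: "insertion \<Rightarrow> graph" where
  "new_graph I = \<lparr> verts = verts (old_graph I) \<union> verts (added_graph I),
     edges = edges (old_graph I) \<union> edges (added_graph I) \<union> (\<lambda>(u, v). {u, v}) ` attachment I \<rparr>"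

definition valid_insertion :: "nat \<Rightarrow> insertion \<Rightarrow> bool" where
  "valid_insertion k I \<longleftrightarrow>
     is_graph (old_graph I) \<and> is_graph (added_graph I) \<and>
     verts (old_graph I) \<inter> verts (added_graph I) = {} \<and>
     attachment I \<subseteq> verts (old_graph I) \<times> verts (added_graph I) \<and>
     (\<forall>v\<in>verts (new_graph I). 0 < weight I v) \<and>
     min_kpath_cover k (old_graph I) (weight I) (old_opt I)"

definition new_order :: "insertion \<Rightarrow> nat" where
  "new_order I = card (verts (new_graph I))"

definition new_max_degree :: "insertion \<Rightarrow> nat" where
  "new_max_degree I = max_degree (new_graph I)"

text \<open>
  The truncated subtraction on \<^typ>\<open>nat\<close> is harmless: it differs from the integer one only for
  maximum degree 0, where the factor in front of the power vanishes. The exponent is nonnegative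
  for \<open>k \<ge> 4\<close>, so \<^const>\<open>nat\<close> loses nothing there; in particular it is 0 for \<open>k = 4\<close>.
\<close>

definition branching_bound :: "nat \<Rightarrow> insertion \<Rightarrow> nat" where
  "branching_bound k I = card (verts (added_graph I)) * new_max_degree I *
     (new_max_degree I - 1) ^ nat \<lceil>(real k - 5) / 2\<rceil>"

text \<open>The order of the new graph tends to infinity, within a given class of insertions.\<close>

definition large_insertions :: "insertion set \<Rightarrow> insertion filter" where
  "large_insertions C = inf (filtercomap new_order at_top) (principal C)"

section \<open>Model of computation\<close>

text \<open>
  Programs are finite systems of first-order recursive functions over binary trees whose atoms
  are real numbers (pure LISP with eager evaluation). Every evaluation step costs one
  time unit; the only numeric operations are addition, subtraction and comparison, and the only
  numeric constant is 0. A program may call an external solver, whose own running time on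
  the query is charged in full. Any value other than \<open>Null\<close> counts as true. All functions are
  unary; variables are de Bruijn indices into the environment.
\<close>

datatype val = Null | Num real | Cell val val

datatype expr =
    EVar nat
  | ENull
  | EZero
  | ECell expr expr
  | EFst expr
  | ESnd expr
  | EAdd expr expr
  | ESub expr expr
  | ELeq expr expr
  | EIf expr expr expr
  | ELet expr expr
  | ECall nat expr
  | EAsk expr

text \<open>A table of function bodies, and the main expression.\<close>

type_synonym program = "expr list \<times> expr"

record solver =
  answer :: "val \<Rightarrow> val"
  steps :: "val \<Rightarrow> nat"

fun val_fst :: "val \<Rightarrow> val" where
  "val_fst (Cell a b) = a"
| "val_fst _ = Null"

fun val_snd :: "val \<Rightarrow> val" where
  "val_snd (Cell a b) = b"
| "val_snd _ = Null"

fun val_add :: "val \<Rightarrow> val \<Rightarrow> val" where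
  "val_add (Num x) (Num y) = Num (x + y)"
| "val_add _ _ = Null"

fun val_sub :: "val \<Rightarrow> val \<Rightarrow> val" where
  "val_sub (Num x) (Num y) = Num (x - y)"
| "val_sub _ _ = Null"

fun val_leq :: "val \<Rightarrow> val \<Rightarrow> val" where
  "val_leq (Num x) (Num y) = (if x \<le> y then Cell Null Null else Null)"
| "val_leq _ _ = Null"

definition lookup :: "val list \<Rightarrow> nat \<Rightarrow> val" where
  "lookup env i = (if i < length env then env ! i else Null)"

text \<open>\<open>big_step fs A env e v t\<close>: expression \<open>e\<close> evaluates to \<open>v\<close> in exactly \<open>t\<close> time units.\<close>

inductive big_step :: "expr list \<Rightarrow> solver \<Rightarrow> val list \<Rightarrow> expr \<Rightarrow> val \<Rightarrow> nat \<Rightarrow> bool"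
  for fs :: "expr list" and A :: solver where
  step_Var: "big_step fs A env (EVar i) (lookup env i) 1"
| step_Null: "big_step fs A env ENull Null 1"
| step_Zero: "big_step fs A env EZero (Num 0) 1"
| step_Cell: "big_step fs A env e1 v1 t1 \<Longrightarrow> big_step fs A env e2 v2 t2 \<Longrightarrow>
    big_step fs A env (ECell e1 e2) (Cell v1 v2) (t1 + t2 + 1)"
| step_Fst: "big_step fs A env e v t \<Longrightarrow> big_step fs A env (EFst e) (val_fst v) (t + 1)"
| step_Snd: "big_step fs A env e v t \<Longrightarrow> big_step fs A env (ESnd e) (val_snd v) (t + 1)"
| step_Add: "big_step fs A env e1 v1 t1 \<Longrightarrow> big_step fs A env e2 v2 t2 \<Longrightarrow>
    big_step fs A env (EAdd e1 e2) (val_add v1 v2) (t1 + t2 + 1)"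
| step_Sub: "big_step fs A env e1 v1 t1 \<Longrightarrow> big_step fs A env e2 v2 t2 \<Longrightarrow>
    big_step fs A env (ESub e1 e2) (val_sub v1 v2) (t1 + t2 + 1)"
| step_Leq: "big_step fs A env e1 v1 t1 \<Longrightarrow> big_step fs A env e2 v2 t2 \<Longrightarrow>
    big_step fs A env (ELeq e1 e2) (val_leq v1 v2) (t1 + t2 + 1)"
| step_IfT: "big_step fs A env e v t \<Longrightarrow> v \<noteq> Null \<Longrightarrow> big_step fs A env e1 v1 t1 \<Longrightarrow>
    big_step fs A env (EIf e e1 e2) v1 (t + t1 + 1)"
| step_IfF: "big_step fs A env e Null t \<Longrightarrow> big_step fs A env e2 v2 t2 \<Longrightarrow>
    big_step fs A env (EIf e e1 e2) v2 (t + t2 + 1)"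
| step_Let: "big_step fs A env e1 v1 t1 \<Longrightarrow> big_step fs A (v1 # env) e2 v2 t2 \<Longrightarrow>
    big_step fs A env (ELet e1 e2) v2 (t1 + t2 + 1)"
| step_Call: "big_step fs A env e v t \<Longrightarrow> f < length fs \<Longrightarrow> big_step fs A [v] (fs ! f) v' t' \<Longrightarrow>
    big_step fs A env (ECall f e) v' (t + t' + 1)"
| step_Ask: "big_step fs A env e v t \<Longrightarrow>
    big_step fs A env (EAsk e) (answer A v) (t + steps A v + 1)"

inductive_cases big_step_elims:
  "big_step fs A env (EVar i) v t"
  "big_step fs A env ENull v t"
  "big_step fs A env EZero v t"
  "big_step fs A env (ECell a b) v t"
  "big_step fs A env (EFst a) v t"
  "big_step fs A env (ESnd a) v t"
  "big_step fs A env (EAdd a b) v t"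
  "big_step fs A env (ESub a b) v t"
  "big_step fs A env (ELeq a b) v t"
  "big_step fs A env (EIf a b c) v t"
  "big_step fs A env (ELet a b) v t"
  "big_step fs A env (ECall f a) v t"
  "big_step fs A env (EAsk a) v t"

lemma big_step_deterministic:
  "big_step fs A env e v t \<Longrightarrow> big_step fs A env e v' t' \<Longrightarrow> v' = v \<and> t' = t"
proof (induction arbitrary: v' t' rule: big_step.induct)
qed (erule big_step_elims; metis Suc_eq_plus1 One_nat_def)+

definition runs :: "program \<Rightarrow> solver \<Rightarrow> val \<Rightarrow> val \<Rightarrow> nat \<Rightarrow> bool" where
  "runs P A x y t \<longleftrightarrow> big_step (fst P) A [x] (snd P) y t"

section \<open>Encodings\<close>

definition enc_list :: "val list \<Rightarrow> val" where
  "enc_list xs = foldr Cell xs Null"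

definition enc_vertex :: "nat \<Rightarrow> val" where
  "enc_vertex v = Num (real v)"

text \<open>
  Sets are represented by their listings without repetition, in any order; an edge
  is stored once, as an ordered pair in either orientation.
\<close>

definition encodes_set :: "nat set \<Rightarrow> val \<Rightarrow> bool" where
  "encodes_set S x \<longleftrightarrow>
     (\<exists>vs. distinct vs \<and> set vs = S \<and> x = enc_list (map enc_vertex vs))"

definition encodes_edges :: "nat set set \<Rightarrow> val \<Rightarrow> bool" where
  "encodes_edges E x \<longleftrightarrow>
     (\<exists>es. distinct (map (\<lambda>(u, v). {u, v}) es) \<and> (\<lambda>(u, v). {u, v}) ` set es = E \<and>
        x = enc_list (map (\<lambda>(u, v). Cell (enc_vertex u) (enc_vertex v)) es))"

definition encodes_graph :: "graph \<Rightarrow> val \<Rightarrow> bool" where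
  "encodes_graph G x \<longleftrightarrow>
     (\<exists>a b. encodes_set (verts G) a \<and> encodes_edges (edges G) b \<and> x = Cell a b)"

definition encodes_weighted_graph :: "graph \<Rightarrow> (nat \<Rightarrow> real) \<Rightarrow> val \<Rightarrow> bool" where
  "encodes_weighted_graph G w x \<longleftrightarrow>
     (\<exists>vs b. distinct vs \<and> set vs = verts G \<and> encodes_edges (edges G) b \<and>
        x = Cell (enc_list (map (\<lambda>v. Cell (enc_vertex v) (Num (w v))) vs)) b)"

definition encodes_insertion :: "insertion \<Rightarrow> val \<Rightarrow> bool" where
  "encodes_insertion I x \<longleftrightarrow>
     (\<exists>a b c. encodes_graph (old_graph I) a \<and>
        encodes_weighted_graph (new_graph I) (weight I) b \<and>
        encodes_set (old_opt I) c \<and> x = Cell a (Cell b c))"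

section \<open>Approximation algorithms\<close>

text \<open>
  The running time is a function of the graph alone: it bounds the number of steps on every
  encoding of the graph, under all nonnegative vertex weights.
\<close>

definition weighted_graph :: "graph \<Rightarrow> (nat \<Rightarrow> real) \<Rightarrow> bool" where
  "weighted_graph G w \<longleftrightarrow> is_graph G \<and> (\<forall>v\<in>verts G. 0 \<le> w v)"

definition approximation_algorithm :: "nat \<Rightarrow> real \<Rightarrow> solver \<Rightarrow> bool" where
  "approximation_algorithm k \<rho> A \<longleftrightarrow>
     (\<forall>G w x. weighted_graph G w \<and> encodes_weighted_graph G w x \<longrightarrow>
        (\<exists>S. encodes_set S (answer A x) \<and> kpath_cover k G S \<and>
          (\<forall>S'. min_kpath_cover k G w S' \<longrightarrow> sum w S \<le> \<rho> * sum w S')))"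

definition has_running_time :: "solver \<Rightarrow> (graph \<Rightarrow> nat) \<Rightarrow> bool" where
  "has_running_time A T \<longleftrightarrow>
     (\<forall>G w x. weighted_graph G w \<and> encodes_weighted_graph G w x \<longrightarrow>
        0 < steps A x \<and> steps A x \<le> T G)"

end

theory Submission
  imports Defs
begin

text \<open>
  Write \<open>V\<^sub>A\<close> for the inserted vertices. Given an optimal cover \<open>S'\<close> of the new graph, let \<open>R\<close> be the set
  of vertices reachable from \<open>V\<^sub>A\<close> in the graph without \<open>S'\<close>, and \<open>F\<close> the part of \<open>S'\<close> that lies in
  \<open>V\<^sub>A\<close> or is adjacent to \<open>R\<close>. Every \<open>k\<close>-path meeting \<open>V\<^sub>A\<close> meets \<open>F\<close>, so \<open>OPT(G\<^sub>O) \<union> F\<close> is a cover, of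
  weight at most \<open>w(S') + w(F)\<close>; the approximation algorithm with \<open>F\<close> made free of charge gives a cover
  of weight at most \<open>w(F) + \<rho> (w(S') - w(F))\<close>. The lighter of the two has ratio \<open>2 - 1/\<rho>\<close>.

  The pair \<open>(R, F)\<close> is found by a binary search tree that decides one vertex at a time,
  always one that lies in \<open>V\<^sub>A\<close> or is adjacent to the vertices already put into \<open>R\<close>, and that keeps \<open>R\<close>
  free of \<open>k\<close>-paths. A connected graph without \<open>k\<close>-paths and of maximum degree \<open>\<Delta> \<ge> 2\<close> has at most
  \<open>(k - 1) (\<Delta> - 1)\<^bsup>(k - 2) div 2\<^esup>\<close> vertices, which bounds the depth of the tree by \<open>k (\<Delta> + 1) b\<close>.
  If \<open>\<Delta> \<le> 1\<close> the bound \<open>b\<close> may vanish, but then there is no \<open>k\<close>-path and the empty cover is optimal.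
\<close>

section \<open>Connected graphs without long paths\<close>

text \<open>End points of walks of at most \<open>j\<close> steps from \<open>v\<close> that never
  go straight back, \<open>u\<close> counting as the vertex visited before \<open>v\<close>. With
  degrees at most \<open>d + 1\<close> each step then has only \<open>d\<close> choices.\<close>

fun branch :: "('a \<Rightarrow> 'a set) \<Rightarrow> 'a \<Rightarrow> 'a \<Rightarrow> nat \<Rightarrow> 'a set" where
  "branch N u v 0 = {v}"
| "branch N u v (Suc j) = insert v (\<Union>x\<in>N v - {u}. branch N v x j)"

lemma card_UN_le_mult:
  assumes "finite I" "\<And>i. i \<in> I \<Longrightarrow> card (B i) \<le> m"
  shows "card (\<Union>i\<in>I. B i) \<le> card I * m"
proof -
  have "card (\<Union>i\<in>I. B i) \<le> (\<Sum>i\<in>I. card (B i))"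
    by (rule card_UN_le[OF assms(1)])
  also have "\<dots> \<le> card I * m"
    using sum_bounded_above[of I "\<lambda>i. card (B i)" m] assms(2) by simp
  finally show ?thesis .
qed

text \<open>Since \<open>u\<close> is a neighbour of \<open>v\<close>, dropping it leaves at most
  \<open>d\<close> neighbours. Symmetry of \<open>N\<close> passes this hypothesis on to the
  recursive calls, where \<open>v\<close> becomes the vertex dropped.\<close>

lemma card_branch:
  assumes "\<And>x y. y \<in> N x \<Longrightarrow> x \<in> N y" "\<And>x. finite (N x)" "\<And>x. card (N x) \<le> Suc d"
    and "u \<in> N v"
  shows "finite (branch N u v j)" "card (branch N u v j) \<le> (\<Sum>t\<le>j. d ^ t)"
proof -
  have "finite (branch N u v j) \<and> card (branch N u v j) \<le> (\<Sum>t\<le>j. d ^ t)"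
    using assms(4)
  proof (induction j arbitrary: u v)
    case 0
    then show ?case by simp
  next
    case (Suc j)
    have IH: "finite (branch N v x j)" "card (branch N v x j) \<le> (\<Sum>t\<le>j. d ^ t)" if "x \<in> N v" for x
      using Suc.IH[of v x] assms(1)[OF that] by auto
    have "card (branch N u v (Suc j)) \<le> Suc (card (\<Union>x\<in>N v - {u}. branch N v x j))"
      by (simp add: card_insert_le_m1 IH assms(2) card_insert_if)
    also have "card (\<Union>x\<in>N v - {u}. branch N v x j) \<le> card (N v - {u}) * (\<Sum>t\<le>j. d ^ t)"
      by (rule card_UN_le_mult) (use assms(2) IH in auto)
    also have "\<dots> \<le> d * (\<Sum>t\<le>j. d ^ t)"
      using Suc.prems assms(2,3)[of v] by (intro mult_le_mono1) auto
    finally have "card (branch N u v (Suc j)) \<le> (\<Sum>t\<le>Suc j. d ^ t)"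
      by (simp add: sum.atMost_Suc_shift sum_distrib_left del: sum.atMost_Suc)
    moreover have "finite (branch N u v (Suc j))"
      using IH assms(2) by auto
    ultimately show ?case by simp
  qed
  then show "finite (branch N u v j)" "card (branch N u v j) \<le> (\<Sum>t\<le>j. d ^ t)"
    by auto
qed

text \<open>A path without repetitions never steps straight back, so \<open>branch\<close> catches
  its end point.\<close>

lemma last_in_branch:
  assumes "successively (\<lambda>x y. y \<in> N x) (v # q)" "distinct (v # q)" "u \<notin> set q" "length q \<le> j"
  shows "last (v # q) \<in> branch N u v j"
  using assms
proof (induction q arbitrary: u v j)
  case Nil
  then show ?case by (cases j) auto
next
  case (Cons x q)
  then obtain j' where "j = Suc j'" by (cases j) auto
  moreover have "last (x # q) \<in> branch N v x j'"
    using Cons calculation by (intro Cons.IH) auto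
  ultimately show ?case
    using Cons.prems by auto
qed

lemma geometric_sum_eq:
  fixes d :: nat
  assumes "1 \<le> d"
  shows "1 + (d - 1) * (\<Sum>t<j. d ^ t) = d ^ j"
proof (induction j)
  case (Suc j)
  have "1 + (d - 1) * (\<Sum>t<Suc j. d ^ t) = (1 + (d - 1) * (\<Sum>t<j. d ^ t)) + (d - 1) * d ^ j"
    by (simp add: algebra_simps)
  also have "\<dots> = d ^ Suc j"
    using assms unfolding Suc.IH by (cases d) auto
  finally show ?case .
qed simp

text \<open>The walk from \<open>a\<close> to \<open>v\<close> is followed step by step: the detour
  restarts whenever the walk returns to \<open>p\<close>, and loses a loop whenever the walk returns
  to the detour. So it stays simple and meets \<open>p\<close> only where it starts.\<close>

lemma reaches_from_path:
  assumes "(\<lambda>x y. x \<in> C \<and> y \<in> C \<and> R x y)\<^sup>*\<^sup>* a v" "a \<in> set p"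
  shows "\<exists>i s. i < length p \<and> successively R (p ! i # s) \<and> distinct (p ! i # s) \<and>
    set s \<inter> set p = {} \<and> set s \<subseteq> C \<and> last (p ! i # s) = v"
  using assms
proof (induction rule: rtranclp_induct)
  case base
  then obtain i where "i < length p" "p ! i = a"
    by (auto simp: in_set_conv_nth)
  then show ?case
    by (intro exI[of _ i] exI[of _ "[]"]) auto
next
  case (step v v')
  then obtain i s where s: "i < length p" "successively R (p ! i # s)" "distinct (p ! i # s)"
    "set s \<inter> set p = {}" "set s \<subseteq> C" "last (p ! i # s) = v"
    by blast
  show ?case
  proof (cases "v' \<in> set p")
    case True
    then obtain i where "i < length p" "p ! i = v'"
      by (auto simp: in_set_conv_nth)
    then show ?thesis
      by (intro exI[of _ i] exI[of _ "[]"]) auto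
  next
    case v'p: False
    show ?thesis
    proof (cases "v' \<in> set s")
      case True
      then obtain s1 s2 where [simp]: "s = s1 @ v' # s2"
        by (meson split_list)
      have "successively R (p ! i # s1 @ [v'])"
        using s(2) successively_append_iff[of R "p ! i # s1 @ [v']" s2] by simp
      then show ?thesis
        using s by (intro exI[of _ i] exI[of _ "s1 @ [v']"]) auto
    next
      case False
      have "successively R ((p ! i # s) @ [v'])"
        unfolding successively_append_iff using s step by auto
      then show ?thesis
        using s step v'p False by (intro exI[of _ i] exI[of _ "s @ [v']"]) auto
    qed
  qed
qed

text \<open>
  Hang the vertices off a longest path \<open>p\<close>: a vertex reached from \<open>p ! i\<close> by a detour of length
  \<open>j\<close> satisfies \<open>j \<le> i\<close> and \<open>j \<le> length p - 1 - i\<close>, since otherwise the detour followed by one of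
  the two halves of \<open>p\<close> would be longer than \<open>p\<close>.
\<close>

lemma card_connected_without_path:
  assumes fin: "finite C" and sym: "\<And>x y. R x y \<Longrightarrow> R y x"
    and deg: "\<And>x. x \<in> C \<Longrightarrow> card {y \<in> C. R x y} \<le> Suc d" and d: "1 \<le> d"
    and conn: "\<And>x. x \<in> C \<Longrightarrow> (\<lambda>x y. x \<in> C \<and> y \<in> C \<and> R x y)\<^sup>*\<^sup>* a x" and a: "a \<in> C"
    and no_path: "\<And>p. distinct p \<Longrightarrow> set p \<subseteq> C \<Longrightarrow> successively R p \<Longrightarrow> length p < k"
  shows "card C \<le> (k - 1) * d ^ ((k - 2) div 2)"
proof -
  define path where "path p \<longleftrightarrow> distinct p \<and> set p \<subseteq> C \<and> successively R p" for p
  have "path [a]" "\<forall>p. path p \<longrightarrow> length p < k"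
    using no_path a by (auto simp: path_def)
  then obtain p where p: "path p" and longest: "\<And>q. path q \<Longrightarrow> length q \<le> length p"
    using ex_has_greatest_nat[of path "[a]" length k] by blast
  have ne: "p \<noteq> []"
    using longest[OF \<open>path [a]\<close>] by auto
  have succ_rev: "successively R (rev xs) = successively R xs" for xs
    unfolding successively_rev by (rule iffI; erule successively_mono; blast intro: sym)
  define E where "E = (\<lambda>x y. x \<in> C \<and> y \<in> C \<and> R x y)"
  have "symp E\<^sup>*\<^sup>*"
    by (rule symp_rtranclp) (auto simp: E_def symp_def sym)
  then have conn': "E\<^sup>*\<^sup>* x y" if "x \<in> C" "y \<in> C" for x y
    using conn[OF that(1), folded E_def] conn[OF that(2), folded E_def]
    by (meson rtranclp_trans sympD)
  define N where "N x = {y. x \<in> C \<and> y \<in> C \<and> R x y}" for x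
  have N_sym: "x \<in> N y" if "y \<in> N x" for x y
    using that sym by (auto simp: N_def)
  have N_fin: "finite (N x)" for x
    by (rule finite_subset[OF _ fin]) (auto simp: N_def)
  have N_card: "card (N x) \<le> Suc d" for x
    using deg[of x] by (cases "x \<in> C") (auto simp: N_def)
  define j where "j i = min i (length p - 1 - i)" for i
  \<comment> \<open>At an inner vertex both neighbours on \<open>p\<close> are left out, so at most
    \<open>d - 1\<close> branches remain and the geometric sum collapses to \<open>d ^ j i\<close>.
    At an end of \<open>p\<close>, where \<open>j i = 0\<close>, there is no room for a
    detour.\<close>
  define B where "B i = (if j i = 0 then {p ! i} else
      insert (p ! i) (\<Union>x\<in>N (p ! i) - {p ! (i - 1), p ! (i + 1)}. branch N (p ! i) x (j i - 1)))" for i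
  have card_B: "card (B i) \<le> d ^ j i" if i: "i < length p" for i
  proof (cases "j i = 0")
    case True
    then show ?thesis by (simp add: B_def)
  next
    case False
    then have i': "i \<ge> 1" "i + 1 < length p"
      by (auto simp: j_def)
    have pR: "R (p ! m) (p ! Suc m)" if "Suc m < length p" for m
      using p that by (simp add: path_def successively_conv_nth)
    have pC: "p ! m \<in> C" if "m < length p" for m
      using p that by (auto simp: path_def)
    have nb: "p ! (i - 1) \<in> N (p ! i)" "p ! (i + 1) \<in> N (p ! i)"
      using pR[of "i - 1"] pR[of i] pC i' by (auto simp: N_def sym)
    have "p ! (i - 1) \<noteq> p ! (i + 1)"
      using p i' by (auto simp: path_def nth_eq_iff_index_eq)
    then have "card (N (p ! i) - {p ! (i - 1), p ! (i + 1)}) = card (N (p ! i)) - 2"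
      using nb by (subst card_Diff_subset) auto
    then have c2: "card (N (p ! i) - {p ! (i - 1), p ! (i + 1)}) \<le> d - 1"
      using N_card[of "p ! i"] by simp
    have br: "finite (branch N (p ! i) x (j i - 1))"
      "card (branch N (p ! i) x (j i - 1)) \<le> (\<Sum>t<j i. d ^ t)" if "x \<in> N (p ! i)" for x
      using card_branch[where N = N, OF N_sym N_fin N_card N_sym[OF that], of "j i - 1"] False
      by (auto simp: lessThan_Suc_atMost[symmetric])
    let ?U = "\<Union>x\<in>N (p ! i) - {p ! (i - 1), p ! (i + 1)}. branch N (p ! i) x (j i - 1)"
    have "card (B i) \<le> 1 + card ?U"
      using False br N_fin by (auto simp: B_def card_insert_if)
    also have "card ?U \<le> card (N (p ! i) - {p ! (i - 1), p ! (i + 1)}) * (\<Sum>t<j i. d ^ t)"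
      by (rule card_UN_le_mult) (use N_fin br in auto)
    also have "\<dots> \<le> (d - 1) * (\<Sum>t<j i. d ^ t)"
      using c2 by (rule mult_le_mono1)
    also have "1 + \<dots> = d ^ j i"
      by (rule geometric_sum_eq[OF d])
    finally show ?thesis by simp
  qed
  have cover: "C \<subseteq> (\<Union>i<length p. B i)"
  proof
    fix v assume v: "v \<in> C"
    have hdp: "hd p \<in> set p" "hd p \<in> C"
      using p ne by (auto simp: path_def)
    obtain i s where s: "i < length p" "successively R (p ! i # s)" "distinct (p ! i # s)"
      "set s \<inter> set p = {}" "set s \<subseteq> C" "last (p ! i # s) = v"
      using reaches_from_path[OF conn'[OF hdp(2) v, unfolded E_def] hdp(1)] by blast
    define P1 P2 where "P1 = take i p" and "P2 = drop (Suc i) p"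
    have p_split: "p = P1 @ p ! i # P2" and len: "length P1 = i" "length P2 = length p - 1 - i"
      using s(1) id_take_nth_drop[OF s(1)] by (auto simp: P1_def P2_def)
    have pR: "successively R (P1 @ p ! i # P2)" and pD: "distinct (P1 @ p ! i # P2)"
      and pC: "set (P1 @ p ! i # P2) \<subseteq> C" and pS: "set s \<inter> set (P1 @ p ! i # P2) = {}"
      using p s(4) p_split by (auto simp: path_def)
    have rs: "successively R (rev s @ [p ! i])"
      using s(2) succ_rev[of "p ! i # s"] by simp
    have "successively R (p ! i # P2)" "successively R (P1 @ [p ! i])"
      using pR successively_append_iff[of R "P1 @ [p ! i]" P2]
      by (simp_all add: successively_append_iff)
    then have "successively R (rev s @ p ! i # P2)" "successively R (rev s @ p ! i # rev P1)"
      using rs succ_rev[of "P1 @ [p ! i]"] by (simp_all add: successively_append_iff)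
    then have "path (rev s @ p ! i # P2)" "path (rev s @ p ! i # rev P1)"
      using s(3,5) pD pC pS by (auto simp: path_def)
    then have "length (rev s @ p ! i # P2) \<le> length p" "length (rev s @ p ! i # rev P1) \<le> length p"
      using longest by blast+
    then have le1: "length s \<le> i" and le2: "length s \<le> length p - 1 - i"
      using s(1) len by auto
    have "v \<in> B i"
    proof (cases s)
      case Nil
      then show ?thesis using s(6) by (auto simp: B_def)
    next
      case (Cons x s')
      have j: "length s' \<le> j i - 1" "j i \<noteq> 0" "i > 0" "i + 1 < length p"
        using le1 le2 Cons by (auto simp: j_def)
      have "set (p ! i # s) \<subseteq> C"
        using s(1,5) p by (auto simp: path_def)
      then have "successively (\<lambda>x y. y \<in> N x) (p ! i # s)"
        by (intro successively_mono[OF s(2)]) (auto simp: N_def)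
      then have x: "x \<in> N (p ! i)" "successively (\<lambda>x y. y \<in> N x) (x # s')"
        using Cons by auto
      have "last (x # s') \<in> branch N (p ! i) x (j i - 1)"
        by (rule last_in_branch[OF x(2)]) (use s Cons j in auto)
      moreover have "x \<noteq> p ! (i - 1)" "x \<noteq> p ! (i + 1)"
        using s(4) Cons j nth_mem[of "i - 1" p] nth_mem[of "i + 1" p] by auto
      ultimately show ?thesis
        using s(6) Cons j x by (auto simp: B_def)
    qed
    then show "v \<in> (\<Union>i<length p. B i)"
      using s(1) by blast
  qed
  have lk: "length p \<le> k - 1"
    using no_path[of p] p by (auto simp: path_def)
  have "card C \<le> card (\<Union>i<length p. B i)"
  proof (rule card_mono[OF _ cover], intro finite_UN_I)
    fix i
    show "finite (B i)"
      using N_fin card_branch(1)[where N = N, OF N_sym N_fin N_card N_sym] by (auto simp: B_def)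
  qed simp
  also have "\<dots> \<le> card {..<length p} * d ^ ((k - 2) div 2)"
  proof (rule card_UN_le_mult)
    fix i assume "i \<in> {..<length p}"
    \<comment> \<open>The two sides of \<open>p ! i\<close> have at most \<open>k - 2\<close>
      vertices together, so the shorter one has at most \<open>(k - 2) div 2\<close>.\<close>
    then have "card (B i) \<le> d ^ j i" "j i \<le> (k - 2) div 2"
      using card_B lk by (auto simp: j_def)
    then show "card (B i) \<le> d ^ ((k - 2) div 2)"
      using power_increasing[OF _ d] le_trans by blast
  qed simp
  also have "\<dots> \<le> (k - 1) * d ^ ((k - 2) div 2)"
    using lk by (intro mult_le_mono1) simp
  finally show ?thesis .
qed

section \<open>Degrees and the size of the explored region\<close>

definition adj :: "graph \<Rightarrow> nat \<Rightarrow> nat \<Rightarrow> bool" where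
  "adj G u v \<longleftrightarrow> {u, v} \<in> edges G"

lemma adj_sym: "adj G u v \<longleftrightarrow> adj G v u"
  by (simp add: adj_def insert_commute)

lemma adj_verts:
  assumes "is_graph G" "adj G u v"
  shows "u \<in> verts G" "v \<in> verts G"
  using assms unfolding is_graph_def adj_def by (metis doubleton_eq_iff)+

lemma is_kpath_iff:
  "is_kpath k G p \<longleftrightarrow> length p = k \<and> distinct p \<and> set p \<subseteq> verts G \<and> successively (adj G) p"
  by (auto simp: is_kpath_def successively_conv_nth adj_def)

lemma finite_edges:
  assumes "is_graph G"
  shows "finite (edges G)"
  by (rule finite_subset[of _ "Pow (verts G)"]) (use assms in \<open>auto simp: is_graph_def\<close>)

lemma card_adj_le:
  assumes "is_graph G"
  shows "card {u. adj G v u} \<le> max_degree G" "finite {u. adj G v u}"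
proof -
  show fin: "finite {u. adj G v u}"
    by (rule finite_subset[of _ "verts G"]) (use assms adj_verts(2)[OF assms] in \<open>auto simp: is_graph_def\<close>)
  show "card {u. adj G v u} \<le> max_degree G"
  proof (cases "v \<in> verts G")
    case True
    have "card {u. adj G v u} \<le> degree G v"
      unfolding degree_def
      by (rule card_inj_on_le[of "\<lambda>u. {v, u}"])
        (use finite_edges[OF assms] in \<open>auto simp: inj_on_def adj_def doubleton_eq_iff\<close>)
    also have "\<dots> \<le> max_degree G"
      unfolding max_degree_def using True assms by (intro Max_ge) (auto simp: is_graph_def)
    finally show ?thesis .
  next
    case False
    then have "{u. adj G v u} = {}"
      using adj_verts[OF assms] by auto
    then show ?thesis by simp
  qed
qed

text \<open>The second vertex of the path has two neighbours on it. This supplies the degree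
  hypothesis of the size bounds below.\<close>

lemma max_degree_ge_2:
  assumes "is_graph G" "is_kpath k G p" "3 \<le> k"
  shows "2 \<le> max_degree G"
proof -
  have "adj G (p ! i) (p ! Suc i)" if "Suc i < k" for i
    using assms(2) that by (simp add: is_kpath_def adj_def)
  from this[of 0] this[of 1] have "adj G (p ! 1) (p ! 0)" "adj G (p ! 1) (p ! 2)"
    using assms(3) by (simp_all add: adj_sym numeral_2_eq_2)
  moreover have "p ! 0 \<noteq> p ! 2"
    using assms(2,3) by (simp add: is_kpath_def nth_eq_iff_index_eq)
  ultimately have "card {p ! 0, p ! 2} \<le> card {u. adj G (p ! 1) u}" "card {p ! 0, p ! 2} = 2"
    using card_adj_le(2)[OF assms(1)] by (intro card_mono, auto)
  then show ?thesis
    using card_adj_le(1)[OF assms(1), of "p ! 1"] by linarith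
qed

text \<open>Every vertex of \<open>In\<close> is reached inside \<open>In\<close> from an inserted
  vertex, so \<open>In\<close> is covered by connected pieces \<open>C a\<close> without
  \<open>k\<close>-paths, each of at most \<open>M\<close> vertices. Apart from inserted vertices
  outside \<open>In\<close>, everything in \<open>In \<union> Out\<close> lies in a piece or next to
  one, which costs a factor of \<open>max_degree G + 1\<close>.\<close>

lemma card_explored:
  assumes G: "is_graph G" and D: "2 \<le> max_degree G" and k: "2 \<le> k" and VA: "finite VA"
    and sub: "In \<subseteq> verts G" and no: "\<And>p. is_kpath k G p \<Longrightarrow> \<not> set p \<subseteq> In"
    and reach: "\<And>u. u \<in> In \<Longrightarrow> \<exists>a\<in>VA \<inter> In. (\<lambda>x y. x \<in> In \<and> y \<in> In \<and> adj G x y)\<^sup>*\<^sup>* a u"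
    and Out: "Out \<subseteq> VA \<union> {v. \<exists>u\<in>In. adj G v u}"
  shows "card (In \<union> Out) \<le>
    card VA * ((max_degree G + 1) * ((k - 1) * (max_degree G - 1) ^ ((k - 2) div 2)))"
proof -
  define D where "D = max_degree G"
  define M where "M = (k - 1) * (D - 1) ^ ((k - 2) div 2)"
  have M: "1 \<le> M"
    using D k by (auto simp: M_def D_def Suc_le_eq)
  define E where "E = (\<lambda>x y. x \<in> In \<and> y \<in> In \<and> adj G x y)"
  define C where "C a = {u. E\<^sup>*\<^sup>* a u}" for a
  have C_In: "C a \<subseteq> In" if "a \<in> In" for a
  proof
    fix u assume "u \<in> C a"
    then have "E\<^sup>*\<^sup>* a u" by (simp add: C_def)
    then show "u \<in> In"
      by (cases rule: rtranclp.cases) (use that in \<open>auto simp: E_def\<close>)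
  qed
  have fin: "finite In"
    using sub G by (meson finite_subset is_graph_def)
  have fC: "finite (C a)" if "a \<in> In" for a
    using C_In[OF that] fin finite_subset by blast
  have cC: "card (C a) \<le> M" if a: "a \<in> In" for a
    unfolding M_def
  proof (rule card_connected_without_path[where a = a and R = "adj G"])
    show "finite (C a)" by (rule fC[OF a])
    show "a \<in> C a" by (simp add: C_def)
    show "1 \<le> D - 1" using D by (simp add: D_def)
    show "card {y \<in> C a. adj G x y} \<le> Suc (D - 1)" for x
    proof -
      have "card {y \<in> C a. adj G x y} \<le> card {y. adj G x y}"
        by (rule card_mono) (use card_adj_le(2)[OF G] in auto)
      then show ?thesis
        using card_adj_le(1)[OF G, of x] by (simp add: D_def)
    qed
    show "(\<lambda>x y. x \<in> C a \<and> y \<in> C a \<and> adj G x y)\<^sup>*\<^sup>* a x" if "x \<in> C a" for x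
    proof -
      have "E\<^sup>*\<^sup>* a x" using that by (simp add: C_def)
      then show ?thesis
      proof (induction rule: rtranclp_induct)
        case (step y z)
        then have "y \<in> C a" "z \<in> C a" "adj G y z"
          by (auto simp: C_def E_def intro: rtranclp.rtrancl_into_rtrancl)
        then show ?case
          using step.IH by (auto intro: rtranclp.rtrancl_into_rtrancl)
      qed simp
    qed
    show "length p < k" if p: "distinct p" "set p \<subseteq> C a" "successively (adj G) p" for p
    proof (rule ccontr)
      assume "\<not> length p < k"
      moreover have "set (take k p) \<subseteq> In"
        using p(2) C_In[OF a] by (meson order_trans set_take_subset)
      moreover have "successively (adj G) (take k p)"
        using p(3) by (auto simp: successively_conv_nth)
      ultimately have "is_kpath k G (take k p)"
        using p sub by (auto simp: is_kpath_iff)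
      then show False
        using no \<open>set (take k p) \<subseteq> In\<close> by blast
    qed
  qed (use adj_sym in blast)
  let ?U = "\<Union>a\<in>VA \<inter> In. \<Union>u\<in>C a. insert u {v. adj G u v}"
  have "In \<union> Out \<subseteq> (VA - In) \<union> ?U"
  proof
    fix x assume "x \<in> In \<union> Out"
    then consider "x \<in> In" | "x \<in> VA" "x \<notin> In" | u where "u \<in> In" "adj G u x"
      using Out adj_sym[of G x] by blast
    then show "x \<in> (VA - In) \<union> ?U"
    proof cases
      case 1
      then show ?thesis using reach[OF 1] by (auto simp: C_def E_def)
    next
      case 2
      then show ?thesis by simp
    next
      case 3
      then show ?thesis using reach[OF 3(1)] by (auto simp: C_def E_def)
    qed
  qed
  moreover have "finite ?U"
    using VA fC card_adj_le(2)[OF G] by auto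
  ultimately have "card (In \<union> Out) \<le> card ((VA - In) \<union> ?U)"
    using VA by (intro card_mono) auto
  also have "\<dots> \<le> card (VA - In) + card ?U"
    by (rule card_Un_le)
  also have "card ?U \<le> card (VA \<inter> In) * ((D + 1) * M)"
  proof (rule card_UN_le_mult)
    fix a assume "a \<in> VA \<inter> In"
    then have a: "a \<in> In" by simp
    have "card (\<Union>u\<in>C a. insert u {v. adj G u v}) \<le> card (C a) * (D + 1)"
    proof (rule card_UN_le_mult[OF fC[OF a]])
      fix u
      show "card (insert u {v. adj G u v}) \<le> D + 1"
        using card_adj_le[OF G, of u] by (simp add: D_def card_insert_if)
    qed
    also have "\<dots> \<le> (D + 1) * M"
      using mult_le_mono1[OF cC[OF a], of "D + 1"] by (simp add: mult.commute)
    finally show "card (\<Union>u\<in>C a. insert u {v. adj G u v}) \<le> (D + 1) * M" .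
  qed (use VA in simp)
  \<comment> \<open>As \<open>M \<ge> 1\<close>, an inserted vertex outside \<open>In\<close> may be
    charged as much as one inside.\<close>
  also have "card (VA - In) + card (VA \<inter> In) * ((D + 1) * M)
      \<le> card (VA - In) * ((D + 1) * M) + card (VA \<inter> In) * ((D + 1) * M)"
    using M by simp
  also have "\<dots> = (card (VA - In) + card (VA \<inter> In)) * ((D + 1) * M)"
    by (simp add: algebra_simps)
  also have "card (VA - In) + card (VA \<inter> In) = card VA"
    using VA by (metis card_Diff_subset_Int card_mono inf_le1 finite_Int le_add_diff_inverse2)
  finally show ?thesis
    by (simp add: M_def D_def)
qed

text \<open>For \<open>k \<ge> 4\<close> the ceiling equals \<open>k div 2 - 2\<close>, one less
  than \<open>(k - 2) div 2\<close>. The extra factor \<open>D - 1\<close> is absorbed by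
  \<open>D\<close>, and \<open>k - 1\<close> by \<open>k\<close>.\<close>

lemma depth_bound_le:
  fixes D :: nat
  assumes "4 \<le> k" "2 \<le> D"
  shows "(k - 1) * (D - 1) ^ ((k - 2) div 2) \<le> k * (D * (D - 1) ^ nat \<lceil>(real k - 5) / 2\<rceil>)"
proof -
  have "\<lceil>(real k - 5) / 2\<rceil> = int (k div 2) - 2"
  proof (rule ceiling_unique)
    have "2 * (k div 2) \<le> k" "k \<le> 2 * (k div 2) + 1"
      by auto
    then have "2 * real (k div 2) \<le> real k" "real k \<le> 2 * real (k div 2) + 1"
      by linarith+
    then show "real_of_int (int (k div 2) - 2) - 1 < (real k - 5) / 2"
      "(real k - 5) / 2 \<le> real_of_int (int (k div 2) - 2)"
      by (auto simp: field_simps)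
  qed
  then have "nat \<lceil>(real k - 5) / 2\<rceil> = k div 2 - 2" "(k - 2) div 2 = Suc (k div 2 - 2)"
    using assms(1) by auto
  then show ?thesis
    by (auto intro!: mult_le_mono)
qed

section \<open>Symbolic evaluation of programs\<close>

definition halts :: "expr list \<Rightarrow> solver \<Rightarrow> nat \<Rightarrow> val \<Rightarrow> bool" where
  "halts fs A f x \<longleftrightarrow> f < length fs \<and> (\<exists>y t. big_step fs A [x] (fs ! f) y t)"

definition out :: "expr list \<Rightarrow> solver \<Rightarrow> nat \<Rightarrow> val \<Rightarrow> val" where
  "out fs A f x = (THE y. \<exists>t. big_step fs A [x] (fs ! f) y t)"

definition dur :: "expr list \<Rightarrow> solver \<Rightarrow> nat \<Rightarrow> val \<Rightarrow> nat" where
  "dur fs A f x = (THE t. \<exists>y. big_step fs A [x] (fs ! f) y t)"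

lemma out_dur_eqI:
  assumes "big_step fs A [x] (fs ! f) y t"
  shows "out fs A f x = y" "dur fs A f x = t"
  unfolding out_def dur_def using assms big_step_deterministic[OF assms] by blast+

context
  fixes fs :: "expr list" and A :: solver
begin

text \<open>Value, cost and safety recurse on the expression alone: a call is not unfolded but left
  as \<open>out\<close>, \<open>dur\<close> and \<open>halts\<close>. Hence the simplifier can
  evaluate a body as soon as facts about its calls are at hand.\<close>

primrec eval_expr :: "expr \<Rightarrow> val list \<Rightarrow> val" where
  "eval_expr (EVar i) env = lookup env i"
| "eval_expr ENull env = Null"
| "eval_expr EZero env = Num 0"
| "eval_expr (ECell a b) env = Cell (eval_expr a env) (eval_expr b env)"
| "eval_expr (EFst a) env = val_fst (eval_expr a env)"
| "eval_expr (ESnd a) env = val_snd (eval_expr a env)"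
| "eval_expr (EAdd a b) env = val_add (eval_expr a env) (eval_expr b env)"
| "eval_expr (ESub a b) env = val_sub (eval_expr a env) (eval_expr b env)"
| "eval_expr (ELeq a b) env = val_leq (eval_expr a env) (eval_expr b env)"
| "eval_expr (EIf c a b) env =
     (if eval_expr c env = Null then eval_expr b env else eval_expr a env)"
| "eval_expr (ELet a b) env = eval_expr b (eval_expr a env # env)"
| "eval_expr (ECall f a) env = out fs A f (eval_expr a env)"
| "eval_expr (EAsk a) env = answer A (eval_expr a env)"

primrec cost_expr :: "expr \<Rightarrow> val list \<Rightarrow> nat" where
  "cost_expr (EVar i) env = 1"
| "cost_expr ENull env = 1"
| "cost_expr EZero env = 1"
| "cost_expr (ECell a b) env = cost_expr a env + cost_expr b env + 1"
| "cost_expr (EFst a) env = cost_expr a env + 1"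
| "cost_expr (ESnd a) env = cost_expr a env + 1"
| "cost_expr (EAdd a b) env = cost_expr a env + cost_expr b env + 1"
| "cost_expr (ESub a b) env = cost_expr a env + cost_expr b env + 1"
| "cost_expr (ELeq a b) env = cost_expr a env + cost_expr b env + 1"
| "cost_expr (EIf c a b) env =
     cost_expr c env + (if eval_expr c env = Null then cost_expr b env else cost_expr a env) + 1"
| "cost_expr (ELet a b) env = cost_expr a env + cost_expr b (eval_expr a env # env) + 1"
| "cost_expr (ECall f a) env = cost_expr a env + dur fs A f (eval_expr a env) + 1"
| "cost_expr (EAsk a) env = cost_expr a env + steps A (eval_expr a env) + 1"

text \<open>Only the branch taken of an \<open>EIf\<close> has to be safe; otherwise a recursive
  body could not be shown to halt even in its base case.\<close>

primrec safe_expr :: "expr \<Rightarrow> val list \<Rightarrow> bool" where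
  "safe_expr (EVar i) env = True"
| "safe_expr ENull env = True"
| "safe_expr EZero env = True"
| "safe_expr (ECell a b) env = (safe_expr a env \<and> safe_expr b env)"
| "safe_expr (EFst a) env = safe_expr a env"
| "safe_expr (ESnd a) env = safe_expr a env"
| "safe_expr (EAdd a b) env = (safe_expr a env \<and> safe_expr b env)"
| "safe_expr (ESub a b) env = (safe_expr a env \<and> safe_expr b env)"
| "safe_expr (ELeq a b) env = (safe_expr a env \<and> safe_expr b env)"
| "safe_expr (EIf c a b) env =
     (safe_expr c env \<and> (if eval_expr c env = Null then safe_expr b env else safe_expr a env))"
| "safe_expr (ELet a b) env = (safe_expr a env \<and> safe_expr b (eval_expr a env # env))"
| "safe_expr (ECall f a) env = (safe_expr a env \<and> halts fs A f (eval_expr a env))"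
| "safe_expr (EAsk a) env = safe_expr a env"

lemma safe_big_step:
  "safe_expr e env \<Longrightarrow> big_step fs A env e (eval_expr e env) (cost_expr e env)"
proof (induction e arbitrary: env)
  case (EIf c a b)
  then show ?case
    using step_IfF[of fs A env c "cost_expr c env" b] step_IfT[of fs A env c "eval_expr c env"]
    by (cases "eval_expr c env = Null") (simp_all, metis+)
next
  case (ECall f a)
  then have f: "f < length fs" and "\<exists>y t. big_step fs A [eval_expr a env] (fs ! f) y t"
    by (auto simp: halts_def)
  then obtain y t where yt: "big_step fs A [eval_expr a env] (fs ! f) y t"
    by blast
  show ?case
    using step_Call[OF ECall.IH f yt] ECall.prems by (simp add: out_dur_eqI[OF yt])
next
  case (ELet a b)
  then show ?case
    using step_Let[OF ELet.IH(1) ELet.IH(2)] by simp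
qed (simp_all only: eval_expr.simps cost_expr.simps safe_expr.simps big_step.intros)

definition computes :: "nat \<Rightarrow> val \<Rightarrow> val \<Rightarrow> nat \<Rightarrow> bool" where
  "computes f x y c \<longleftrightarrow> halts fs A f x \<and> out fs A f x = y \<and> dur fs A f x \<le> c"

text \<open>This is how each function is verified: its body is evaluated symbolically, and the
  induction hypothesis, split by \<open>computesD\<close>, answers the recursive calls.\<close>

lemma computesI:
  assumes "f < length fs" "fs ! f = e" "safe_expr e [x]" "eval_expr e [x] = y" "cost_expr e [x] \<le> c"
  shows "computes f x y c"
proof -
  have bs: "big_step fs A [x] (fs ! f) y (cost_expr e [x])"
    using safe_big_step[OF assms(3)] assms(2,4) by simp
  then show ?thesis
    using assms(1,5) unfolding computes_def halts_def out_dur_eqI[OF bs] by blast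
qed

lemma computesD:
  assumes "computes f x y c"
  shows "halts fs A f x" "out fs A f x = y" "dur fs A f x \<le> c"
  using assms by (auto simp: computes_def)

lemma computes_mono: "computes f x y c \<Longrightarrow> c \<le> c' \<Longrightarrow> computes f x y c'"
  by (auto simp: computes_def)

end

section \<open>The program\<close>

definition truth :: "bool \<Rightarrow> val" where
  "truth b = (if b then Cell Null Null else Null)"

lemma truth_eq_Null [simp]: "truth b = Null \<longleftrightarrow> \<not> b"
  by (simp add: truth_def)

abbreviation "ETrue \<equiv> ECell ENull ENull"
abbreviation "ENot a \<equiv> EIf a ENull ETrue"
abbreviation "EAnd a b \<equiv> EIf a b ENull"
abbreviation "EOr a b \<equiv> EIf a ETrue b"
abbreviation "EEq a b \<equiv> EAnd (ELeq a b) (ELeq b a)"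

abbreviation "tail1 e \<equiv> ESnd e"
abbreviation "tail2 e \<equiv> ESnd (tail1 e)"
abbreviation "tail3 e \<equiv> ESnd (tail2 e)"
abbreviation "tail4 e \<equiv> ESnd (tail3 e)"
abbreviation "tail5 e \<equiv> ESnd (tail4 e)"
abbreviation "tail6 e \<equiv> ESnd (tail5 e)"
abbreviation "tail7 e \<equiv> ESnd (tail6 e)"
abbreviation "comp1 e \<equiv> EFst e"
abbreviation "comp2 e \<equiv> EFst (tail1 e)"
abbreviation "comp3 e \<equiv> EFst (tail2 e)"
abbreviation "comp5 e \<equiv> EFst (tail4 e)"
abbreviation "comp6 e \<equiv> EFst (tail5 e)"
abbreviation "comp7 e \<equiv> EFst (tail6 e)"
abbreviation "arg \<equiv> EVar 0"

text \<open>\<open>ECall i\<close> calls entry \<open>i\<close> of \<open>table\<close> below.\<close>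

definition mem_body :: expr where
  "mem_body = EIf (tail1 arg)
     (EOr (EEq (comp1 arg) (comp2 arg)) (ECall 0 (ECell (comp1 arg) (tail2 arg)))) ENull"

text \<open>The argument is \<open>(v, us, es)\<close>; an edge counts in either orientation, since
  the encoding fixes none.\<close>

definition adj_body :: expr where
  "adj_body = EIf (tail2 arg)
     (EOr (EAnd (EEq (comp1 arg) (EFst (EFst (tail2 arg)))) (ECall 0 (ECell (ESnd (EFst (tail2 arg))) (comp2 arg))))
     (EOr (EAnd (EEq (comp1 arg) (ESnd (EFst (tail2 arg)))) (ECall 0 (ECell (EFst (EFst (tail2 arg))) (comp2 arg))))
       (ECall 1 (ECell (comp1 arg) (ECell (comp2 arg) (ESnd (tail2 arg))))))) ENull"

text \<open>Backtracking for a path. The argument is \<open>(m, candidates, path, full, es)\<close>: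
  \<open>m\<close> vertices, in unary, are still missing, the next one is taken from the candidates,
  \<open>path\<close> has its latest vertex first, and \<open>full\<close> holds all admissible
  vertices.\<close>

definition extend_body :: expr where
  "extend_body = EIf (comp1 arg) (EIf (comp2 arg)
     (EOr
       (EAnd (ENot (ECall 0 (ECell (EFst (comp2 arg)) (comp3 arg))))
       (EAnd (EOr (ENot (comp3 arg))
           (ECall 1 (ECell (EFst (comp2 arg)) (ECell (ECell (EFst (comp3 arg)) ENull) (ESnd (tail3 arg))))))
         (ECall 2 (ECell (ESnd (comp1 arg)) (ECell (EFst (tail3 arg)) (ECell (ECell (EFst (comp2 arg)) (comp3 arg)) (tail3 arg)))))))
       (ECall 2 (ECell (comp1 arg) (ECell (ESnd (comp2 arg)) (tail2 arg))))) ENull) ETrue"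

text \<open>
  The argument of \<open>pick_body\<close> is \<open>(candidates, In, Out, VN, VO, EN, \<dots>)\<close>, the last part being
  the context of \<open>search_body\<close>.
\<close>

definition pick_body :: expr where
  "pick_body = EIf (comp1 arg)
     (EIf (EAnd (ENot (ECall 0 (ECell (EFst (comp1 arg)) (comp2 arg))))
          (EAnd (ENot (ECall 0 (ECell (EFst (comp1 arg)) (comp3 arg))))
          (EOr (ENot (ECall 0 (ECell (EFst (comp1 arg)) (EFst (ESnd (tail3 arg))))))
            (ECall 1 (ECell (EFst (comp1 arg)) (ECell (comp2 arg) (EFst (ESnd (ESnd (tail3 arg))))))))))
       (EFst (comp1 arg))
       (ECall 3 (ECell (ESnd (comp1 arg)) (tail1 arg)))) ENull"

definition wsum_body :: expr where
  "wsum_body = EIf (comp1 arg)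
     (EAdd (EIf (ECall 0 (ECell (EFst (EFst (comp1 arg))) (tail1 arg))) (ESnd (EFst (comp1 arg))) EZero)
       (ECall 4 (ECell (ESnd (comp1 arg)) (tail1 arg)))) EZero"

definition union_body :: expr where
  "union_body = EIf (comp1 arg)
     (EIf (ECall 0 (ECell (EFst (comp1 arg)) (tail1 arg)))
       (ECall 5 (ECell (ESnd (comp1 arg)) (tail1 arg)))
       (ECell (EFst (comp1 arg)) (ECall 5 (ECell (ESnd (comp1 arg)) (tail1 arg))))) (tail1 arg)"

definition zero_body :: expr where
  "zero_body = EIf (comp1 arg)
     (ECell (ECell (EFst (EFst (comp1 arg)))
         (EIf (ECall 0 (ECell (EFst (EFst (comp1 arg))) (tail1 arg))) EZero (ESnd (EFst (comp1 arg)))))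
       (ECall 6 (ECell (ESnd (comp1 arg)) (tail1 arg)))) ENull"

definition proj_body :: expr where
  "proj_body = EIf (EVar 0) (ECell (EFst (EFst (EVar 0))) (ECall 7 (ESnd (EVar 0)))) ENull"

definition better_body :: expr where
  "better_body = EIf (ELeq (ECall 4 (ECell (comp1 arg) (comp2 arg))) (ECall 4 (ECell (comp1 arg) (tail2 arg)))) (comp2 arg) (tail2 arg)"

text \<open>The argument of \<open>search_body\<close> is \<open>(In, Out, VN, VO, EN, WN, OPT, k)\<close>, with \<open>k\<close> in unary.\<close>

definition search_body :: expr where
  "search_body = ELet (ECall 3 (ECell (comp3 arg) arg))
    (EIf (EVar 0)
      (ELet (ECall 9 (ECell (comp1 (EVar 1)) (ECell (ECell (EVar 0) (comp2 (EVar 1))) (tail2 (EVar 1)))))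
        (EIf (ECall 2 (ECell (tail7 (EVar 2)) (ECell (ECell (EVar 1) (comp1 (EVar 2)))
               (ECell ENull (ECell (ECell (EVar 1) (comp1 (EVar 2))) (comp5 (EVar 2)))))))
          (EVar 0)
          (ECall 8 (ECell (comp6 (EVar 2)) (ECell (EVar 0)
            (ECall 9 (ECell (ECell (EVar 1) (comp1 (EVar 2))) (tail1 (EVar 2)))))))))
      (ECall 8 (ECell (comp6 (EVar 1)) (ECell
        (ECall 5 (ECell (comp7 (EVar 1)) (comp2 (EVar 1))))
        (EAsk (ECell (ECall 6 (ECell (comp6 (EVar 1)) (comp2 (EVar 1)))) (comp5 (EVar 1))))))))"

definition table :: "expr list" where
  "table = [mem_body, adj_body, extend_body, pick_body, wsum_body, union_body, zero_body,
     proj_body, better_body, search_body]"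

primrec unary_expr :: "nat \<Rightarrow> expr" where
  "unary_expr 0 = ENull"
| "unary_expr (Suc n) = ECell ENull (unary_expr n)"

primrec unary :: "nat \<Rightarrow> val" where
  "unary 0 = Null"
| "unary (Suc n) = Cell Null (unary n)"

text \<open>A new graph without \<open>k\<close>-paths is answered at once by \<open>ENull\<close>,
  the empty cover: the bound on the depth of the search relies on the existence of a
  \<open>k\<close>-path. Otherwise the search starts with nothing decided.\<close>

definition main_expr :: "nat \<Rightarrow> expr" where
  "main_expr k = ELet (ECall 7 (EFst (EFst (ESnd (EVar 0)))))
    (EIf (ECall 2 (ECell (unary_expr k) (ECell (EVar 0) (ECell ENull
           (ECell (EVar 0) (ESnd (EFst (ESnd (EVar 1)))))))))
      (ECall 9 (ECell ENull (ECell ENull (ECell (EVar 0) (ECell (EFst (EFst (EVar 1)))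
        (ECell (ESnd (EFst (ESnd (EVar 1)))) (ECell (EFst (EFst (ESnd (EVar 1))))
          (ECell (ESnd (ESnd (EVar 1))) (unary_expr k)))))))))
      ENull)"

lemma table_simps [simp]:
  "length table = 10" "table ! 0 = mem_body" "table ! Suc 0 = adj_body" "table ! 2 = extend_body"
  "table ! 3 = pick_body" "table ! 4 = wsum_body" "table ! 5 = union_body" "table ! 6 = zero_body"
  "table ! 7 = proj_body" "table ! 8 = better_body" "table ! 9 = search_body"
  by (simp_all add: table_def eval_nat_numeral)

section \<open>Lists as values, and what the subroutines decide\<close>

definition enc_verts :: "nat list \<Rightarrow> val" where
  "enc_verts vs = enc_list (map enc_vertex vs)"

definition enc_edges :: "(nat \<times> nat) list \<Rightarrow> val" where
  "enc_edges es = enc_list (map (\<lambda>(u, v). Cell (enc_vertex u) (enc_vertex v)) es)"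

definition enc_weights :: "(nat \<Rightarrow> real) \<Rightarrow> nat list \<Rightarrow> val" where
  "enc_weights w vs = enc_list (map (\<lambda>v. Cell (enc_vertex v) (Num (w v))) vs)"

lemma enc_simps [simp]:
  "enc_verts [] = Null" "enc_verts (v # vs) = Cell (Num (real v)) (enc_verts vs)"
  "enc_edges [] = Null"
  "enc_edges (e # es) = Cell (Cell (Num (real (fst e))) (Num (real (snd e)))) (enc_edges es)"
  "enc_weights w [] = Null"
  "enc_weights w (v # vs) = Cell (Cell (Num (real v)) (Num (w v))) (enc_weights w vs)"
  by (simp_all add: enc_verts_def enc_edges_def enc_weights_def enc_list_def enc_vertex_def
      split: prod.split)

lemma enc_verts_eq_Null [simp]: "enc_verts vs = Null \<longleftrightarrow> vs = []"
  by (cases vs) auto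

lemma enc_edges_eq_Null [simp]: "enc_edges es = Null \<longleftrightarrow> es = []"
  by (cases es) auto

lemma enc_weights_eq_Null [simp]: "enc_weights w vs = Null \<longleftrightarrow> vs = []"
  by (cases vs) auto

lemma lookup_simps [simp]:
  "lookup (x # env) 0 = x" "lookup (x # env) (Suc i) = lookup env i"
  "lookup (x # env) (numeral m) = lookup env (pred_numeral m)"
  by (simp_all add: lookup_def numeral_eq_Suc)

definition listed_adj :: "(nat \<times> nat) list \<Rightarrow> nat \<Rightarrow> nat \<Rightarrow> bool" where
  "listed_adj es u v \<longleftrightarrow> (\<exists>e\<in>set es. u = fst e \<and> v = snd e \<or> u = snd e \<and> v = fst e)"

lemma listed_adj_Cons [simp]:
  "listed_adj (e # es) u v \<longleftrightarrow>
     u = fst e \<and> v = snd e \<or> u = snd e \<and> v = fst e \<or> listed_adj es u v"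
  by (auto simp: listed_adj_def)

lemma listed_adj_Nil [simp]: "\<not> listed_adj [] u v"
  by (simp add: listed_adj_def)

text \<open>The list \<open>q\<close> holds the vertices that \<open>extend_body\<close> has yet to
  find. Of \<open>path\<close> only the head, if any, must be adjacent to the first of them, so
  \<open>path = []\<close> and \<open>m = k\<close> ask for a \<open>k\<close>-path inside
  \<open>full\<close>.\<close>

definition extends :: "(nat \<times> nat) list \<Rightarrow> nat list \<Rightarrow> nat \<Rightarrow> nat list \<Rightarrow> nat list \<Rightarrow> bool" where
  "extends es full m cs path \<longleftrightarrow> (\<exists>q. length q = m \<and> (q \<noteq> [] \<longrightarrow> hd q \<in> set cs) \<and>
     set q \<subseteq> set full \<and> distinct q \<and> set q \<inter> set path = {} \<and>
     successively (listed_adj es) (take 1 path @ q))"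

lemma extends_0: "extends es full 0 cs path"
  unfolding extends_def by (rule exI[of _ "[]"]) (cases path; simp)

lemma extends_Suc_Nil: "\<not> extends es full (Suc m) [] path"
  by (auto simp: extends_def)

lemma listed_adj_sym: "listed_adj es u v \<longleftrightarrow> listed_adj es v u"
  by (auto simp: listed_adj_def)

text \<open>The next vertex is either \<open>c\<close> or a later candidate. The assumption on
  \<open>c\<close> stands in for a membership test that the program does not make.\<close>

lemma extends_Suc_Cons:
  assumes "c \<in> set full"
  shows "extends es full (Suc m) (c # cs) path \<longleftrightarrow>
    c \<notin> set path \<and> (path = [] \<or> listed_adj es c (hd path)) \<and> extends es full m full (c # path) \<or>
    extends es full (Suc m) cs path" (is "?L \<longleftrightarrow> ?M \<or> ?R")
proof
  assume ?L
  then obtain q where q: "length q = Suc m" "hd q \<in> set (c # cs)" "set q \<subseteq> set full" "distinct q"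
    "set q \<inter> set path = {}" "successively (listed_adj es) (take 1 path @ q)"
    unfolding extends_def by (metis length_0_conv nat.distinct(1))
  then obtain c' q' where [simp]: "q = c' # q'"
    by (cases q) auto
  show "?M \<or> ?R"
  proof (cases "c' \<in> set cs")
    case True
    then have ?R
      using q unfolding extends_def by (intro exI[of _ q]) simp
    then show ?thesis ..
  next
    case False
    then have [simp]: "c' = c"
      using q by auto
    have "extends es full m full (c # path)"
      unfolding extends_def using q
      by (intro exI[of _ q']) (cases q'; cases path; auto)
    then have ?M
      using q by (cases path) (auto simp: listed_adj_sym)
    then show ?thesis ..
  qed
next
  assume "?M \<or> ?R"
  then show ?L
  proof
    assume M: ?M
    then obtain q where q: "length q = m" "set q \<subseteq> set full" "distinct q"
      "set q \<inter> set (c # path) = {}" "successively (listed_adj es) (c # q)"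
      unfolding extends_def by auto
    then show ?L
      unfolding extends_def using M assms
      by (intro exI[of _ "c # q"]) (cases path; auto simp: listed_adj_sym)
  next
    assume ?R
    then show ?L
      unfolding extends_def by auto
  qed
qed

text \<open>Inserted vertices are recognised by their absence from \<open>vo\<close>, because the
  input lists the old graph and the new graph but not the inserted one.\<close>

definition frontier :: "(nat \<times> nat) list \<Rightarrow> nat list \<Rightarrow> nat list \<Rightarrow> nat list \<Rightarrow> nat \<Rightarrow> bool" where
  "frontier es vo ins outs v \<longleftrightarrow> v \<notin> set ins \<and> v \<notin> set outs \<and>
     (v \<notin> set vo \<or> (\<exists>u\<in>set ins. listed_adj es v u))"

definition listed_weight :: "(nat \<Rightarrow> real) \<Rightarrow> nat list \<Rightarrow> nat list \<Rightarrow> real" where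
  "listed_weight w vs S = (\<Sum>v\<leftarrow>vs. if v \<in> set S then w v else 0)"

lemma unary_expr_eval [simp]:
  "eval_expr fs A (unary_expr k) env = unary k" "safe_expr fs A (unary_expr k) env"
  "cost_expr fs A (unary_expr k) env = 2 * k + 1"
  by (induction k) auto

section \<open>Values and step counts of the subroutines\<close>

context
  fixes A :: solver
begin

text \<open>The numerical constants here and in the bounds that follow are merely chosen large
  enough for the induction to close.\<close>

lemma mem_computes:
  "computes table A 0 (Cell (Num (real x)) (enc_verts vs)) (truth (x \<in> set vs)) (30 * (length vs + 1))"
proof (induction vs)
  case Nil
  show ?case by (rule computesI) (auto simp: mem_body_def truth_def)
next
  case (Cons v vs)
  show ?case
    by (rule computesI) (use computesD[OF Cons.IH] in \<open>auto simp: mem_body_def truth_def\<close>)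
qed

lemmas mem_simps = mem_computes[THEN computesD(1)] mem_computes[THEN computesD(2)]

lemma adj_computes:
  fixes us :: "nat list"
  defines "K \<equiv> 60 * (length us + 1) + 100"
  shows "computes table A 1 (Cell (Num (real v)) (Cell (enc_verts us) (enc_edges es)))
    (truth (\<exists>u\<in>set us. listed_adj es v u)) ((length es + 1) * K)"
proof (induction es)
  case Nil
  show ?case by (rule computesI) (auto simp: adj_body_def truth_def K_def)
next
  case (Cons e es)
  have d: "dur table A 0 (Cell (Num (real x)) (enc_verts us)) \<le> 30 * (length us + 1)" for x
    by (rule computesD(3)[OF mem_computes])
  have step: "(\<exists>u\<in>set us. listed_adj (e # es) v u) \<longleftrightarrow> v = fst e \<and> snd e \<in> set us \<or>
      v = snd e \<and> fst e \<in> set us \<or> (\<exists>u\<in>set us. listed_adj es v u)"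
    by auto
  show ?case
    unfolding step
    by (rule computesI)
      (use computesD[OF Cons.IH] d[of "fst e"] d[of "snd e"] in
        \<open>auto simp: adj_body_def truth_def mem_simps K_def\<close>)
qed

text \<open>The simplifier turns the table index 1 into \<open>Suc 0\<close>, so the facts are kept
  in that form.\<close>

lemmas adj_simps = adj_computes[unfolded One_nat_def, THEN computesD(1)]
  adj_computes[unfolded One_nat_def, THEN computesD(2)]

text \<open>A candidate costs its own tests, at most \<open>K\<close>, and one search through all of
  \<open>full\<close> with \<open>m\<close> smaller by one. The base \<open>length full + 2\<close>
  instead of \<open>length full + 1\<close> makes room for the tests. The bound on
  \<open>length path + m\<close> keeps membership tests on \<open>path\<close> within
  \<open>30 * (k + 1)\<close>, and 220 is the bound of \<open>adj_computes\<close> for a one-element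
  list.\<close>

lemma extend_computes:
  fixes es :: "(nat \<times> nat) list" and k :: nat
  defines "K \<equiv> 30 * (k + 1) + (length es + 1) * 220 + 200"
  assumes "set cs \<subseteq> set full" "length path + m \<le> k"
  shows "computes table A 2 (Cell (unary m) (Cell (enc_verts cs) (Cell (enc_verts path)
      (Cell (enc_verts full) (enc_edges es)))))
    (truth (extends es full m cs path)) (K * (length cs + 1) * (length full + 2) ^ m)"
  using assms(2,3)
proof (induction m arbitrary: cs path)
  case 0
  show ?case
    by (rule computesI) (auto simp: extend_body_def extends_0 truth_def K_def)
next
  case (Suc m)
  from Suc.prems show ?case
  proof (induction cs)
    case Nil
    have "13 \<le> K * 1" by (simp add: K_def)
    also have "\<dots> \<le> K * (length full + 2) ^ Suc m"
      by (intro mult_le_mono one_le_power) auto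
    finally show ?case
      by (intro computesI) (auto simp: extend_body_def extends_Suc_Nil truth_def)
  next
    case (Cons c cs)
    have IH1: "computes table A 2 (Cell (unary (Suc m)) (Cell (enc_verts cs) (Cell (enc_verts path)
        (Cell (enc_verts full) (enc_edges es)))))
      (truth (extends es full (Suc m) cs path)) (K * (length cs + 1) * (length full + 2) ^ Suc m)"
      using Cons by simp
    have IH2: "computes table A 2 (Cell (unary m) (Cell (enc_verts full) (Cell (enc_verts (c # path))
        (Cell (enc_verts full) (enc_edges es)))))
      (truth (extends es full m full (c # path))) (K * (length full + 1) * (length full + 2) ^ m)"
      using Cons.prems by (intro Suc.IH) auto
    have d0: "dur table A 0 (Cell (Num (real c)) (enc_verts path)) \<le> 30 * (k + 1)"
      using computesD(3)[OF mem_computes[of c path]] Cons.prems by simp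
    have d1: "dur table A (Suc 0) (Cell (Num (real c)) (Cell (Cell (Num (real u)) Null) (enc_edges es)))
        \<le> (length es + 1) * 220" for u
      using computesD(3)[OF adj_computes[of c "[u]" es]] by simp
    have a: "halts table A (Suc 0) (Cell (Num (real c)) (Cell (Cell (Num (real u)) Null) (enc_edges es)))"
      "out table A (Suc 0) (Cell (Num (real c)) (Cell (Cell (Num (real u)) Null) (enc_edges es)))
         = truth (listed_adj es c u)" for u
      using computesD[OF adj_computes[of c "[u]" es]] by simp_all
    \<comment> \<open>Names for the products keep the cost comparisons below linear.\<close>
    define X Y where "X = K * (length full + 1) * (length full + 2) ^ m"
      and "Y = K * (length cs + 1) * (length full + 2) ^ Suc m"
    have "K * 1 \<le> K * (length full + 2) ^ m"
      by (intro mult_le_mono) auto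
    then have XY: "K + X + Y \<le> K * (length (c # cs) + 1) * (length full + 2) ^ Suc m"
      by (simp add: X_def Y_def algebra_simps)
    have cf: "c \<in> set full"
      using Cons.prems by simp
    note ext = extends_Suc_Cons[OF cf, of es m cs path]
    show ?case
    proof (rule computes_mono[OF _ XY], cases path)
      case Nil
      show "computes table A 2 (Cell (unary (Suc m)) (Cell (enc_verts (c # cs)) (Cell (enc_verts path)
        (Cell (enc_verts full) (enc_edges es)))))
        (truth (extends es full (Suc m) (c # cs) path)) (K + X + Y)"
        by (rule computesI)
          (use computesD[OF IH1, folded Y_def] computesD[OF IH2, folded X_def] d0 Nil ext
              mem_simps[of c path] in
            \<open>auto simp: extend_body_def K_def truth_def split: if_splits\<close>)
    next
      case (Cons u us)
      show "computes table A 2 (Cell (unary (Suc m)) (Cell (enc_verts (c # cs)) (Cell (enc_verts path)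
        (Cell (enc_verts full) (enc_edges es)))))
        (truth (extends es full (Suc m) (c # cs) path)) (K + X + Y)"
        by (rule computesI)
          (use computesD[OF IH1, folded Y_def] computesD[OF IH2, folded X_def] d0 d1[of u] a[of u] Cons
              ext mem_simps[of c path] in
            \<open>auto simp: extend_body_def K_def truth_def split: if_splits\<close>)
    qed
  qed
qed

text \<open>\<open>Null\<close> reports that no candidate qualifies; a vertex, even 0, is a
  \<open>Num\<close> and therefore counts as true.\<close>

lemma pick_computes:
  fixes ins outs vo :: "nat list" and es :: "(nat \<times> nat) list"
  defines "K \<equiv> 30 * (length ins + length outs + length vo + 3)
    + (length es + 1) * (60 * (length ins + 1) + 100) + 200"
  shows "computes table A 3 (Cell (enc_verts cs) (Cell (enc_verts ins) (Cell (enc_verts outs)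
      (Cell vn (Cell (enc_verts vo) (Cell (enc_edges es) r))))))
    (case find (frontier es vo ins outs) cs of None \<Rightarrow> Null | Some v \<Rightarrow> Num (real v))
    ((length cs + 1) * K)"
proof (induction cs)
  case Nil
  show ?case by (rule computesI) (auto simp: pick_body_def K_def)
next
  case (Cons c cs)
  have d: "dur table A 0 (Cell (Num (real c)) (enc_verts us)) \<le> 30 * (length us + 1)" for us
    by (rule computesD(3)[OF mem_computes])
  have d1: "dur table A (Suc 0) (Cell (Num (real c)) (Cell (enc_verts ins) (enc_edges es)))
      \<le> (length es + 1) * (60 * (length ins + 1) + 100)"
    using computesD(3)[OF adj_computes[of c ins es]] by simp
  define X Y where "X = (length es + 1) * (60 * (length ins + 1) + 100)"
    and "Y = (length cs + 1) * K"
  have K: "30 * (length ins + length outs + length vo + 3) + X + 200 + Y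
      = (length (c # cs) + 1) * K"
    by (simp add: K_def X_def Y_def)
  show ?case
    unfolding K[symmetric]
    by (rule computesI)
      (use computesD[OF Cons.IH, folded Y_def] d[of ins] d[of outs] d[of vo] d1[folded X_def] in
        \<open>auto simp: pick_body_def mem_simps adj_simps frontier_def truth_def\<close>)
qed

lemma wsum_computes:
  "computes table A 4 (Cell (enc_weights w vs) (enc_verts S)) (Num (listed_weight w vs S))
    ((length vs + 1) * (30 * (length S + 1) + 40))"
proof (induction vs)
  case Nil
  show ?case by (rule computesI) (auto simp: wsum_body_def listed_weight_def)
next
  case (Cons v vs)
  define Y where "Y = (length vs + 1) * (30 * (length S + 1) + 40)"
  have d: "dur table A 0 (Cell (Num (real v)) (enc_verts S)) \<le> 30 * (length S + 1)"
    by (rule computesD(3)[OF mem_computes])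
  have K: "Y + 30 * (length S + 1) + 40 = (length (v # vs) + 1) * (30 * (length S + 1) + 40)"
    by (simp add: Y_def)
  show ?case
    unfolding K[symmetric]
    by (rule computesI)
      (use computesD[OF Cons.IH, folded Y_def] d in
        \<open>auto simp: wsum_body_def mem_simps listed_weight_def truth_def\<close>)
qed

lemma union_computes:
  "computes table A 5 (Cell (enc_verts us) (enc_verts vs))
    (enc_verts (filter (\<lambda>u. u \<notin> set vs) us @ vs)) ((length us + 1) * (30 * (length vs + 1) + 40))"
proof (induction us)
  case Nil
  show ?case by (rule computesI) (auto simp: union_body_def)
next
  case (Cons u us)
  define Y where "Y = (length us + 1) * (30 * (length vs + 1) + 40)"
  have d: "dur table A 0 (Cell (Num (real u)) (enc_verts vs)) \<le> 30 * (length vs + 1)"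
    by (rule computesD(3)[OF mem_computes])
  have K: "Y + 30 * (length vs + 1) + 40 = (length (u # us) + 1) * (30 * (length vs + 1) + 40)"
    by (simp add: Y_def)
  show ?case
    unfolding K[symmetric]
    by (rule computesI)
      (use computesD[OF Cons.IH, folded Y_def] d in \<open>auto simp: union_body_def mem_simps truth_def\<close>)
qed

lemma zero_computes:
  "computes table A 6 (Cell (enc_weights w vs) (enc_verts S))
    (enc_weights (\<lambda>v. if v \<in> set S then 0 else w v) vs) ((length vs + 1) * (30 * (length S + 1) + 40))"
proof (induction vs)
  case Nil
  show ?case by (rule computesI) (auto simp: zero_body_def)
next
  case (Cons v vs)
  define Y where "Y = (length vs + 1) * (30 * (length S + 1) + 40)"
  have d: "dur table A 0 (Cell (Num (real v)) (enc_verts S)) \<le> 30 * (length S + 1)"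
    by (rule computesD(3)[OF mem_computes])
  have K: "Y + 30 * (length S + 1) + 40 = (length (v # vs) + 1) * (30 * (length S + 1) + 40)"
    by (simp add: Y_def)
  show ?case
    unfolding K[symmetric]
    by (rule computesI)
      (use computesD[OF Cons.IH, folded Y_def] d in \<open>auto simp: zero_body_def mem_simps truth_def\<close>)
qed

lemma proj_computes: "computes table A 7 (enc_weights w vs) (enc_verts vs) (20 * (length vs + 1))"
proof (induction vs)
  case Nil
  show ?case by (rule computesI) (auto simp: proj_body_def)
next
  case (Cons v vs)
  show ?case
    by (rule computesI) (use computesD[OF Cons.IH] in \<open>auto simp: proj_body_def\<close>)
qed

lemma better_computes:
  "computes table A 8 (Cell (enc_weights w vs) (Cell (enc_verts S) (enc_verts S')))
    (enc_verts (if listed_weight w vs S \<le> listed_weight w vs S' then S else S'))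
    ((length vs + 1) * (30 * (length S + length S' + 2) + 80) + 40)"
proof -
  define X Y where "X = (length vs + 1) * (30 * (length S + 1) + 40)"
    and "Y = (length vs + 1) * (30 * (length S' + 1) + 40)"
  have K: "X + Y + 40 = (length vs + 1) * (30 * (length S + length S' + 2) + 80) + 40"
    by (simp add: X_def Y_def algebra_simps)
  show ?thesis
    unfolding K[symmetric]
    by (rule computesI)
      (use computesD[OF wsum_computes[of w vs S], folded X_def]
          computesD[OF wsum_computes[of w vs S'], folded Y_def] in
        \<open>auto simp: better_body_def\<close>)
qed

end

section \<open>Correctness and running time\<close>

text \<open>Membership in \<open>S\<close> cannot change between consecutive entries, so
  \<open>p\<close> lies inside \<open>S\<close> or misses it.\<close>

lemma successively_closed:
  assumes "successively R p" "\<And>u v. u \<in> set p \<Longrightarrow> v \<in> set p \<Longrightarrow> R u v \<Longrightarrow> u \<in> S \<longleftrightarrow> v \<in> S"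
    and "x \<in> set p" "x \<in> S"
  shows "set p \<subseteq> S"
proof -
  have "set p \<subseteq> S \<or> set p \<inter> S = {}"
    using assms(1,2) by (induction p rule: induct_list012) auto
  then show ?thesis
    using assms(3,4) by auto
qed


text \<open>There are finitely many covers, and for \<open>k \<ge> 1\<close> the set of all vertices
  is one. The guarantee of the solver needs such a minimum as its reference.\<close>

lemma min_kpath_cover_exists:
  assumes "is_graph G" "1 \<le> k"
  shows "\<exists>S. min_kpath_cover k G w S"
proof -
  have fin: "finite {S. kpath_cover k G S}"
    by (rule finite_subset[of _ "Pow (verts G)"])
      (use assms in \<open>auto simp: is_graph_def kpath_cover_def\<close>)
  have "set p \<inter> verts G \<noteq> {}" if "is_kpath k G p" for p
    using that assms(2) by (cases p) (auto simp: is_kpath_def)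
  then have "{S. kpath_cover k G S} \<noteq> {}"
    by (auto simp: kpath_cover_def)
  from ex_min_if_finite[of "sum w ` {S. kpath_cover k G S}"] fin this show ?thesis
    by (auto simp: min_kpath_cover_def not_less)
qed

text \<open>Taking \<open>a\<close> with coefficient \<open>\<rho> - 1\<close> and \<open>b\<close>
  with coefficient 1 makes \<open>f\<close> cancel and leaves \<open>(2 * \<rho> - 1) * opt\<close>;
  the coefficients add up to \<open>\<rho>\<close>.\<close>

lemma reopt_ratio:
  fixes a b f opt \<rho> :: real
  assumes "1 \<le> \<rho>" "a \<le> opt + f" "b \<le> f + \<rho> * (opt - f)"
  shows "min a b \<le> (2 - 1 / \<rho>) * opt"
proof -
  have "\<rho> * min a b = (\<rho> - 1) * min a b + min a b"
    by (simp add: algebra_simps)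
  also have "\<dots> \<le> (\<rho> - 1) * (opt + f) + (f + \<rho> * (opt - f))"
    using assms by (intro add_mono mult_left_mono) auto
  also have "\<dots> = \<rho> * ((2 - 1 / \<rho>) * opt)"
    using assms(1) by (simp add: field_simps)
  finally show ?thesis
    using assms(1) by simp
qed

lemma listed_weight_eq:
  assumes "distinct vs" "set S \<subseteq> set vs"
  shows "listed_weight w vs S = sum w (set S)"
proof -
  have "listed_weight w vs S = (\<Sum>v\<in>set vs. if v \<in> set S then w v else 0)"
    unfolding listed_weight_def using assms(1) by (rule sum_list_distinct_conv_sum_set)
  also have "\<dots> = sum w (set vs \<inter> set S)"
    by (simp add: sum.inter_restrict)
  finally show ?thesis
    using assms(2) by (simp add: Int_absorb1)
qed

lemma card_edges_le:
  assumes "is_graph G"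
  shows "card (edges G) \<le> card (verts G) ^ 2"
proof -
  have fin: "finite (verts G)"
    using assms by (simp add: is_graph_def)
  have "edges G \<subseteq> (\<lambda>(u, v). {u, v}) ` (verts G \<times> verts G)"
    using assms by (force simp: is_graph_def)
  then have "card (edges G) \<le> card ((\<lambda>(u, v). {u, v}) ` (verts G \<times> verts G))"
    using fin by (intro card_mono) auto
  also have "\<dots> \<le> card (verts G \<times> verts G)"
    by (rule card_image_le) (use fin in auto)
  finally show ?thesis
    by (simp add: power2_eq_square card_cartesian_product)
qed

section \<open>One instance with the listings of its encoding\<close>

locale reoptimization =
  fixes k :: nat and \<rho> :: real and A :: solver and T :: "graph \<Rightarrow> nat" and I :: insertion
    and vn vo opt :: "nat list" and es :: "(nat \<times> nat) list"
  assumes k4: "4 \<le> k" and rho: "1 \<le> \<rho>" and approx: "approximation_algorithm k \<rho> A"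
    and time: "has_running_time A T" and valid: "valid_insertion k I"
    and vn: "distinct vn" "set vn = verts (new_graph I)"
    and vo: "distinct vo" "set vo = verts (old_graph I)"
    and opt: "distinct opt" "set opt = old_opt I"
    and es: "distinct (map (\<lambda>(u, v). {u, v}) es)" "(\<lambda>(u, v). {u, v}) ` set es = edges (new_graph I)"
begin

abbreviation "G \<equiv> new_graph I"
abbreviation "w \<equiv> weight I"
abbreviation "VA \<equiv> verts (added_graph I)"

definition depth :: nat where
  "depth = k * (new_max_degree I + 1) * branching_bound k I"

definition ctx :: val where
  "ctx = Cell (enc_verts vn) (Cell (enc_verts vo) (Cell (enc_edges es)
     (Cell (enc_weights w vn) (Cell (enc_verts opt) (unary k)))))"

text \<open>The test for \<open>k\<close>-paths needs degree \<open>k + 3\<close> (\<open>k\<close>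
  levels, the first candidates, the edge list) and \<open>pick_body\<close> degree 4, so degree
  \<open>k + 4\<close> serves for both. The factor \<open>k + 1\<close> comes from scanning the
  current path.\<close>

definition poly_bound :: nat where
  "poly_bound = (k + 1) * (length vn + 2) ^ (k + 4)"

text \<open>Work in one node of the search tree outside its recursive calls. The solver is asked
  only at leaves, once each.\<close>

definition node_bound :: nat where
  "node_bound = 3000 * poly_bound + T G"

lemma G: "is_graph G"
proof -
  have *: "attachment I \<subseteq> verts (old_graph I) \<times> VA" "verts (old_graph I) \<inter> VA = {}"
    "is_graph (old_graph I)" "is_graph (added_graph I)"
    using valid by (auto simp: valid_insertion_def)
  have "\<exists>u\<in>verts G. \<exists>v\<in>verts G. u \<noteq> v \<and> e = {u, v}" if "e \<in> edges G" for e
  proof -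
    from that consider "e \<in> edges (old_graph I)" | "e \<in> edges (added_graph I)"
      | u v where "(u, v) \<in> attachment I" "e = {u, v}"
      by (auto simp: new_graph_def)
    then show ?thesis
    proof cases
      case 1
      then obtain u v where uv: "u \<in> verts (old_graph I)" "v \<in> verts (old_graph I)" "u \<noteq> v" "e = {u, v}"
        using *(3) unfolding is_graph_def by blast
      then have "u \<in> verts G" "v \<in> verts G"
        by (simp_all add: new_graph_def)
      then show ?thesis using uv(3,4) by blast
    next
      case 2
      then obtain u v where uv: "u \<in> verts (added_graph I)" "v \<in> verts (added_graph I)" "u \<noteq> v" "e = {u, v}"
        using *(4) unfolding is_graph_def by blast
      then have "u \<in> verts G" "v \<in> verts G"
        by (simp_all add: new_graph_def)
      then show ?thesis using uv(3,4) by blast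
    next
      case 3
      then have "u \<in> verts G" "v \<in> verts G" "u \<noteq> v"
        using *(1,2) by (auto simp: new_graph_def)
      then show ?thesis using 3(2) by blast
    qed
  qed
  then show ?thesis
    using *(3,4) by (simp add: is_graph_def new_graph_def)
qed

text \<open>Inserted edges and attachment edges all have an end in \<open>VA\<close>.\<close>

lemma adj_old:
  assumes "adj G u v" "u \<in> verts (old_graph I)" "v \<in> verts (old_graph I)"
  shows "adj (old_graph I) u v"
proof -
  have *: "attachment I \<subseteq> verts (old_graph I) \<times> VA" "verts (old_graph I) \<inter> VA = {}"
    "is_graph (added_graph I)"
    using valid by (auto simp: valid_insertion_def)
  have "{u, v} \<notin> edges (added_graph I)"
    using adj_verts(1)[OF *(3), of u v] assms(2) *(2) by (auto simp: adj_def)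
  moreover have "{u, v} \<notin> (\<lambda>(u, v). {u, v}) ` attachment I"
    using assms(2,3) *(1,2) by (auto simp: doubleton_eq_iff)
  ultimately show ?thesis
    using assms(1) by (auto simp: adj_def new_graph_def)
qed

lemma listed_adj_iff: "listed_adj es u v \<longleftrightarrow> adj G u v"
proof -
  have "adj G u v \<longleftrightarrow> (\<exists>e\<in>set es. {u, v} = {fst e, snd e})"
    unfolding adj_def es(2)[symmetric] by (simp add: image_iff case_prod_unfold)
  then show ?thesis
    by (simp add: listed_adj_def doubleton_eq_iff)
qed

lemma weight_nonneg: "v \<in> verts G \<Longrightarrow> 0 \<le> w v"
  using valid unfolding valid_insertion_def by (meson less_imp_le)

lemma extends_iff:
  assumes "set full \<subseteq> verts G"
  shows "extends es full k full [] \<longleftrightarrow> (\<exists>q. is_kpath k G q \<and> set q \<subseteq> set full)"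
proof -
  have adj: "listed_adj es = adj G"
    by (intro ext) (simp add: listed_adj_iff)
  have hd: "hd q \<in> set full" if "length q = k" "set q \<subseteq> set full" for q
  proof -
    have "q \<noteq> []"
      using that(1) k4 by auto
    then show ?thesis
      using that(2) hd_in_set by blast
  qed
  show ?thesis
    unfolding extends_def is_kpath_iff adj using assms hd by (simp, blast)
qed

lemma lengths:
  "length vn = card (verts G)" "length es \<le> (length vn) ^ 2" "length vo \<le> length vn"
  "length opt \<le> length vn"
proof -
  show n: "length vn = card (verts G)"
    using distinct_card[OF vn(1)] vn(2) by simp
  have "length es = card (edges G)"
    using distinct_card[OF es(1)] es(2) by simp
  then show "length es \<le> (length vn) ^ 2"
    using card_edges_le[OF G] n by simp
  have fin: "finite (verts G)"
    using G by (simp add: is_graph_def)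
  have "set vo \<subseteq> verts G" "set opt \<subseteq> verts G"
    using valid by (auto simp: vo opt valid_insertion_def min_kpath_cover_def kpath_cover_def new_graph_def)
  then show "length vo \<le> length vn" "length opt \<le> length vn"
    unfolding n using distinct_card[OF vo(1)] distinct_card[OF opt(1)] card_mono[OF fin] by metis+
qed

lemma length_le_n: "distinct xs \<Longrightarrow> set xs \<subseteq> verts G \<Longrightarrow> length xs \<le> length vn"
  using lengths(1) distinct_card[of xs] card_mono[of "verts G" "set xs"] G by (simp add: is_graph_def)

section \<open>The invariant of the search\<close>

text \<open>\<open>ins\<close> and \<open>outs\<close> are the parts of \<open>R\<close> and
  \<open>F\<close> decided so far. The last three conditions, on paths, reachability and adjacency,
  are the ones under which \<open>card_explored\<close> bounds their size.\<close>

definition explored :: "nat list \<Rightarrow> nat list \<Rightarrow> bool" where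
  "explored ins outs \<longleftrightarrow> distinct ins \<and> distinct outs \<and> set ins \<inter> set outs = {} \<and>
     set ins \<subseteq> verts G \<and> set outs \<subseteq> verts G \<and>
     (\<forall>p. is_kpath k G p \<longrightarrow> \<not> set p \<subseteq> set ins) \<and>
     (\<forall>u\<in>set ins. \<exists>a\<in>VA \<inter> set ins.
        (\<lambda>x y. x \<in> set ins \<and> y \<in> set ins \<and> adj G x y)\<^sup>*\<^sup>* a u) \<and>
     set outs \<subseteq> VA \<union> {v. \<exists>u\<in>set ins. adj G v u}"

lemma frontier_iff:
  assumes "v \<in> verts G"
  shows "frontier es vo ins outs v \<longleftrightarrow> v \<notin> set ins \<and> v \<notin> set outs \<and>
     (v \<in> VA \<or> (\<exists>u\<in>set ins. adj G v u))"
proof -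
  have "verts G = set vo \<union> VA" "set vo \<inter> VA = {}"
    using valid by (simp_all add: valid_insertion_def new_graph_def vo)
  then have "v \<notin> set vo \<longleftrightarrow> v \<in> VA"
    using assms by blast
  then show ?thesis
    by (simp add: frontier_def listed_adj_iff)
qed

text \<open>Every step down the tree decides one more vertex, so this bound on decided vertices
  limits the depth of the tree.\<close>

lemma explored_depth:
  assumes "explored ins outs" "is_kpath k G p"
  shows "length ins + length outs \<le> depth"
proof -
  have "finite VA"
    using valid by (auto simp: valid_insertion_def is_graph_def)
  have D: "2 \<le> max_degree G"
    by (rule max_degree_ge_2[OF G assms(2)]) (use k4 in simp)
  have "length ins + length outs = card (set ins \<union> set outs)"
    using assms(1) by (simp add: explored_def card_Un_disjoint distinct_card)
  also have "\<dots> \<le> card VA * ((max_degree G + 1) * ((k - 1) * (max_degree G - 1) ^ ((k - 2) div 2)))"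
    by (rule card_explored[OF G D _ \<open>finite VA\<close>]) (use assms(1) k4 in \<open>auto simp: explored_def\<close>)
  also have "\<dots> \<le> card VA * ((max_degree G + 1) *
      (k * (max_degree G * (max_degree G - 1) ^ nat \<lceil>(real k - 5) / 2\<rceil>)))"
    by (intro mult_le_mono2 depth_bound_le[OF k4 D])
  also have "\<dots> = depth"
    by (simp add: depth_def branching_bound_def new_max_degree_def algebra_simps)
  finally show ?thesis .
qed

lemma explored_Nil: "explored [] []"
proof -
  have "set p \<noteq> {}" if "is_kpath k G p" for p
    using that k4 by (auto simp: is_kpath_def)
  then show ?thesis
    by (simp add: explored_def)
qed

lemma explored_out:
  assumes "explored ins outs" "frontier es vo ins outs v" "v \<in> verts G"
  shows "explored ins (v # outs)"
proof -
  have "v \<in> VA \<union> {x. \<exists>u\<in>set ins. adj G x u}" "v \<notin> set ins" "v \<notin> set outs"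
    using assms(2) by (simp_all add: frontier_iff[OF assms(3)])
  then show ?thesis
    using assms(1,3) unfolding explored_def by simp
qed

text \<open>A frontier vertex is inserted itself, or is adjacent to some \<open>u\<close> in
  \<open>ins\<close>; then a walk from an inserted vertex to \<open>u\<close> is prolonged by one
  step.\<close>

lemma explored_in:
  assumes ex: "explored ins outs" and fr: "frontier es vo ins outs v" and v: "v \<in> verts G"
    and no: "\<And>p. is_kpath k G p \<Longrightarrow> \<not> set p \<subseteq> set (v # ins)"
  shows "explored (v # ins) outs"
proof -
  let ?E = "\<lambda>ins x y. x \<in> set ins \<and> y \<in> set ins \<and> adj G x y"
  have mono: "(?E (v # ins))\<^sup>*\<^sup>* a u" if "(?E ins)\<^sup>*\<^sup>* a u" for a u
    using that by (rule rtranclp_mono[THEN predicate2D, rotated]) auto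
  have old: "\<exists>a\<in>VA \<inter> set (v # ins). (?E (v # ins))\<^sup>*\<^sup>* a u" if "u \<in> set ins" for u
    using that ex mono unfolding explored_def by (meson IntD1 IntD2 IntI list.set_intros(2))
  have "\<exists>a\<in>VA \<inter> set (v # ins). (?E (v # ins))\<^sup>*\<^sup>* a v"
  proof (cases "v \<in> VA")
    case True
    then show ?thesis by auto
  next
    case False
    then obtain u where u: "u \<in> set ins" "adj G v u"
      using fr v by (auto simp: frontier_iff)
    then obtain a where "a \<in> VA \<inter> set (v # ins)" "(?E (v # ins))\<^sup>*\<^sup>* a u"
      using old by blast
    moreover have "?E (v # ins) u v"
      using u adj_sym[THEN iffD1, OF u(2)] by simp
    ultimately show ?thesis
      using rtranclp.rtrancl_into_rtrancl[of "?E (v # ins)" a u v] by blast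
  qed
  with old have "\<forall>u\<in>set (v # ins). \<exists>a\<in>VA \<inter> set (v # ins). (?E (v # ins))\<^sup>*\<^sup>* a u"
    by simp
  moreover have "set outs \<subseteq> VA \<union> {x. \<exists>u\<in>set (v # ins). adj G x u}"
    using ex by (auto simp: explored_def)
  moreover have "distinct (v # ins)" "distinct outs" "set (v # ins) \<inter> set outs = {}"
     "set (v # ins) \<subseteq> verts G" "set outs \<subseteq> verts G"
    using ex fr[unfolded frontier_iff[OF v]] v by (simp_all add: explored_def)
  ultimately show ?thesis
    using no unfolding explored_def by blast
qed

text \<open>A \<open>k\<close>-path of old vertices only is hit by \<open>old_opt I\<close>. Any
  other one meets \<open>VA\<close>; if it avoided \<open>outs\<close>, it would meet
  \<open>ins\<close> and, with the frontier empty, could never leave it, but \<open>ins\<close>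
  contains no \<open>k\<close>-path.\<close>

lemma leaf_cover:
  assumes ex: "explored ins outs" and leaf: "\<And>v. v \<in> verts G \<Longrightarrow> \<not> frontier es vo ins outs v"
  shows "kpath_cover k G (old_opt I \<union> set outs)"
proof -
  have old: "kpath_cover k (old_graph I) (old_opt I)"
    using valid by (simp add: valid_insertion_def min_kpath_cover_def)
  have "set p \<inter> (old_opt I \<union> set outs) \<noteq> {}" if p: "is_kpath k G p" for p
  proof
    assume disj: "set p \<inter> (old_opt I \<union> set outs) = {}"
    show False
    proof (cases "set p \<subseteq> verts (old_graph I)")
      case True
      have "successively (adj G) p"
        using p by (simp add: is_kpath_iff)
      then have "successively (adj (old_graph I)) p"
        by (rule successively_mono) (use True adj_old in blast)
      then have "is_kpath k (old_graph I) p"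
        using p True by (simp add: is_kpath_iff)
      then show False
        using old disj by (auto simp: kpath_cover_def)
    next
      case False
      have pV: "set p \<subseteq> verts G"
        using p by (simp add: is_kpath_iff)
      then obtain x where x: "x \<in> set p" "x \<in> VA"
        using False by (auto simp: new_graph_def)
      have closed: "v \<in> set ins" if "v \<in> set p" "v \<in> VA \<or> (\<exists>u\<in>set ins. adj G v u)" for v
        using leaf[of v] that pV disj by (auto simp: frontier_iff)
      have "set p \<subseteq> set ins"
      proof (rule successively_closed[of "adj G" p _ x])
        show "successively (adj G) p"
          using p by (simp add: is_kpath_iff)
        show "x \<in> set ins"
          using closed x by blast
        show "u \<in> set ins \<longleftrightarrow> v \<in> set ins" if "u \<in> set p" "v \<in> set p" "adj G u v" for u v
          using that closed[of u] closed[of v] adj_sym[of G u v] by blast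
      qed (use x in simp)
      then show False
        using ex p by (auto simp: explored_def)
    qed
  qed
  moreover have "old_opt I \<union> set outs \<subseteq> verts G"
    using old ex by (auto simp: kpath_cover_def explored_def new_graph_def)
  ultimately show ?thesis
    by (simp add: kpath_cover_def)
qed

section \<open>Comparison with a cover of the new graph\<close>

text \<open>The old vertices of \<open>S'\<close> cover the old graph, and the remaining ones have
  nonnegative weight.\<close>

lemma old_opt_weight:
  assumes "kpath_cover k G S'"
  shows "sum w (old_opt I) \<le> sum w S'"
proof -
  have "kpath_cover k (old_graph I) (S' \<inter> verts (old_graph I))"
  proof -
    have "set p \<inter> (S' \<inter> verts (old_graph I)) \<noteq> {}" if p: "is_kpath k (old_graph I) p" for p
    proof -
      have "is_kpath k G p"
        using p by (auto simp: is_kpath_def new_graph_def)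
      then show ?thesis
        using assms p by (auto simp: kpath_cover_def is_kpath_def) blast
    qed
    then show ?thesis
      by (simp add: kpath_cover_def)
  qed
  then have "sum w (old_opt I) \<le> sum w (S' \<inter> verts (old_graph I))"
    using valid by (simp add: valid_insertion_def min_kpath_cover_def)
  also have "\<dots> \<le> sum w S'"
  proof (rule sum_mono2)
    show "finite S'"
      using assms G by (meson finite_subset is_graph_def kpath_cover_def)
    show "0 \<le> w v" if "v \<in> S' - S' \<inter> verts (old_graph I)" for v
      using that assms weight_nonneg by (auto simp: kpath_cover_def)
  qed simp
  finally show ?thesis .
qed

text \<open>
  Instead of deleting the vertices of \<open>outs\<close> the solver is asked about the whole graph with their
  weights set to 0: its running time is only known on that graph.
\<close>

definition query :: "nat list \<Rightarrow> val" where
  "query outs = Cell (enc_weights (\<lambda>v. if v \<in> set outs then 0 else w v) vn) (enc_edges es)"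

lemma query_encodes:
  "weighted_graph G (\<lambda>v. if v \<in> set outs then 0 else w v)"
  "encodes_weighted_graph G (\<lambda>v. if v \<in> set outs then 0 else w v) (query outs)"
proof -
  show "weighted_graph G (\<lambda>v. if v \<in> set outs then 0 else w v)"
    using G weight_nonneg by (simp add: weighted_graph_def)
  have "encodes_edges (edges G) (enc_edges es)"
    unfolding encodes_edges_def enc_edges_def using es by blast
  then show "encodes_weighted_graph G (\<lambda>v. if v \<in> set outs then 0 else w v) (query outs)"
    unfolding encodes_weighted_graph_def query_def enc_weights_def using vn by blast
qed

lemma query_time: "steps A (query outs) \<le> T G"
  using time query_encodes unfolding has_running_time_def by blast

text \<open>Allows \<open>T G\<close> to enter the final bound as a factor although a node adds it
  to its other work.\<close>

lemma T_pos: "1 \<le> T G"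
proof -
  have "0 < steps A (query [])"
    using time query_encodes[of "[]"] unfolding has_running_time_def by blast
  then show ?thesis
    using query_time[of "[]"] by linarith
qed

text \<open>With \<open>outs\<close> free of charge, a cover \<open>S'\<close> containing
  \<open>outs\<close> costs \<open>sum w S' - sum w (set outs)\<close>. The guarantee applies to
  this cost, and going back to the true weights adds at most
  \<open>sum w (set outs)\<close>.\<close>

lemma query_answer:
  obtains S where "answer A (query outs) = enc_verts S" "distinct S" "kpath_cover k G (set S)"
    "\<And>S'. kpath_cover k G S' \<Longrightarrow> set outs \<subseteq> S' \<Longrightarrow>
       sum w (set S) \<le> sum w (set outs) + \<rho> * (sum w S' - sum w (set outs))"
proof -
  define w' where "w' = (\<lambda>v. if v \<in> set outs then 0 else w v)"
  obtain S where S: "encodes_set S (answer A (query outs))" "kpath_cover k G S"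
    "\<And>S'. min_kpath_cover k G w' S' \<Longrightarrow> sum w' S \<le> \<rho> * sum w' S'"
    using approx query_encodes[of outs] unfolding approximation_algorithm_def w'_def by blast
  obtain vs where vs: "distinct vs" "set vs = S" "answer A (query outs) = enc_verts vs"
    using S(1) unfolding encodes_set_def enc_verts_def by blast
  have fin: "finite S'" if "kpath_cover k G S'" for S'
    using that G by (meson finite_subset is_graph_def kpath_cover_def)
  have "sum w S \<le> sum w (set outs) + \<rho> * (sum w S' - sum w (set outs))"
    if S': "kpath_cover k G S'" "set outs \<subseteq> S'" for S'
  proof -
    obtain M where M: "min_kpath_cover k G w' M"
      using min_kpath_cover_exists[OF G] k4 by fastforce
    have outs: "0 \<le> w v" if "v \<in> set outs" for v
      using that S' weight_nonneg by (auto simp: kpath_cover_def)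
    have "sum w S = sum w' S + sum w (S \<inter> set outs)"
      using fin[OF S(2)] unfolding w'_def
      by (simp add: sum.inter_restrict sum.distrib[symmetric] if_distrib cong: if_cong)
    also have "sum w (S \<inter> set outs) \<le> sum w (set outs)"
      by (rule sum_mono2) (use outs in auto)
    also have "sum w' S \<le> \<rho> * sum w' S'"
    proof -
      have "sum w' S \<le> \<rho> * sum w' M"
        by (rule S(3)[OF M])
      also have "\<dots> \<le> \<rho> * sum w' S'"
        using M S'(1) rho by (intro mult_left_mono) (auto simp: min_kpath_cover_def)
      finally show ?thesis .
    qed
    also have "sum w' S' = sum w S' - sum w (set outs)"
    proof -
      have "sum w' S' = sum w' (S' - set outs) + sum w' (set outs)"
        by (rule sum.subset_diff[OF S'(2) fin[OF S'(1)]])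
      moreover have "sum w S' = sum w (S' - set outs) + sum w (set outs)"
        by (rule sum.subset_diff[OF S'(2) fin[OF S'(1)]])
      moreover have "sum w' (S' - set outs) = sum w (S' - set outs)" "sum w' (set outs) = 0"
        by (auto simp: w'_def intro!: sum.cong)
      ultimately show ?thesis by simp
    qed
    finally show ?thesis by simp
  qed
  then show ?thesis
    using that[OF vs(3,1)] S(2) vs(2) by blast
qed

section \<open>Polynomial bounds for the work in one node\<close>

lemma power_le_poly_bound: "j \<le> 4 \<Longrightarrow> (length vn + 2) ^ j \<le> poly_bound"
proof -
  assume "j \<le> 4"
  then have "(length vn + 2) ^ j \<le> (length vn + 2) ^ (k + 4)"
    by (intro power_increasing) auto
  also have "\<dots> \<le> poly_bound"
    by (simp add: poly_bound_def)
  finally show ?thesis .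
qed

lemma poly_bound_ge: "1 \<le> poly_bound" "k \<le> poly_bound" "length vn \<le> poly_bound"
proof -
  show "1 \<le> poly_bound" "length vn \<le> poly_bound"
    using power_le_poly_bound[of 0] power_le_poly_bound[of 1] by auto
  have "(k + 1) * 1 \<le> poly_bound"
    unfolding poly_bound_def by (intro mult_le_mono2) auto
  then show "k \<le> poly_bound" by simp
qed

lemma quadratic_bound:
  assumes "a \<le> length vn" "b \<le> length vn"
  shows "(a + 1) * (30 * (b + 1) + 40) \<le> 70 * poly_bound"
proof -
  let ?N = "length vn + 2"
  have "(a + 1) * (30 * (b + 1) + 40) \<le> ?N * (70 * ?N)"
    using assms by (intro mult_le_mono) auto
  also have "\<dots> = 70 * ?N ^ 2"
    by (simp add: power2_eq_square algebra_simps)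
  also have "\<dots> \<le> 70 * poly_bound"
    using power_le_poly_bound[of 2] by simp
  finally show ?thesis .
qed

lemma better_bound:
  assumes "length S \<le> length vn" "length S' \<le> length vn"
  shows "(length vn + 1) * (30 * (length S + length S' + 2) + 80) + 40 \<le> 180 * poly_bound"
proof -
  have "(length vn + 1) * (30 * (length S + length S' + 2) + 80) =
      (length vn + 1) * (30 * (length S + 1) + 40) + (length vn + 1) * (30 * (length S' + 1) + 40)"
    by (simp add: algebra_simps)
  then show ?thesis
    using quadratic_bound[OF order_refl assms(1)] quadratic_bound[OF order_refl assms(2)]
      poly_bound_ge(1) by linarith
qed

lemma edge_bound: "length es + 1 \<le> (length vn + 2) ^ 2"
  using lengths(2) by (simp add: power2_eq_square)

lemma pick_bound:
  assumes "length ins \<le> length vn" "length outs \<le> length vn"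
  shows "(length vn + 1) * (30 * (length ins + length outs + length vo + 3)
    + (length es + 1) * (60 * (length ins + 1) + 100) + 200) \<le> 450 * poly_bound"
proof -
  let ?N = "length vn + 2"
  have "(length es + 1) * (60 * (length ins + 1) + 100) \<le> ?N ^ 2 * (160 * ?N)"
    using edge_bound assms by (intro mult_le_mono) auto
  moreover have "30 * (length ins + length outs + length vo + 3) \<le> 90 * ?N"
    using assms lengths(3) by simp
  ultimately have "30 * (length ins + length outs + length vo + 3)
      + (length es + 1) * (60 * (length ins + 1) + 100) + 200 \<le> 90 * ?N + ?N ^ 2 * (160 * ?N) + 200"
    by linarith
  then have "(length vn + 1) * (30 * (length ins + length outs + length vo + 3)
      + (length es + 1) * (60 * (length ins + 1) + 100) + 200)
    \<le> ?N * (90 * ?N + ?N ^ 2 * (160 * ?N) + 200)"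
    by (rule mult_le_mono[rotated]) simp
  also have "\<dots> = 90 * ?N ^ 2 + 160 * ?N ^ 4 + 200 * ?N ^ 1"
    by (simp add: power2_eq_square power4_eq_xxxx ring_distribs del: add_2_eq_Suc')
  also have "\<dots> \<le> 90 * poly_bound + 160 * poly_bound + 200 * poly_bound"
    by (intro add_le_mono mult_le_mono2 power_le_poly_bound) auto
  finally show ?thesis by simp
qed

lemma extend_bound:
  assumes "length full \<le> length vn"
  shows "(30 * (k + 1) + (length es + 1) * 220 + 200) * (length full + 1) * (length full + 2) ^ k
    \<le> 450 * poly_bound"
proof -
  let ?N = "length vn + 2"
  have "(30 * (k + 1) + (length es + 1) * 220 + 200) * (length full + 1)
      \<le> (30 * (k + 1) + ?N ^ 2 * 220 + 200) * ?N"
    using edge_bound assms by (intro mult_le_mono add_le_mono) auto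
  also have "\<dots> = 30 * (k + 1) * ?N + 220 * ?N ^ 3 + 200 * ?N"
    by (simp add: power2_eq_square power3_eq_cube ring_distribs del: add_2_eq_Suc')
  also have "\<dots> \<le> 30 * (k + 1) * ?N ^ 4 + 220 * ((k + 1) * ?N ^ 4) + 200 * ((k + 1) * ?N ^ 4)"
  proof (intro add_le_mono mult_le_mono2)
    have P: "?N ^ i \<le> ?N ^ 4" if "i \<le> 4" for i
      using that by (intro power_increasing) auto
    show "?N \<le> ?N ^ 4"
      using P[of 1] by simp
    show "?N ^ 3 \<le> (k + 1) * ?N ^ 4" "?N \<le> (k + 1) * ?N ^ 4"
      using P[of 3] P[of 1] by (simp_all add: trans_le_add1)
  qed
  also have "\<dots> = 450 * ((k + 1) * ?N ^ 4)"
    by (simp add: algebra_simps)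
  finally have "(30 * (k + 1) + (length es + 1) * 220 + 200) * (length full + 1) * (length full + 2) ^ k
      \<le> 450 * ((k + 1) * ?N ^ 4) * ?N ^ k"
    by (rule mult_le_mono) (use assms in \<open>auto intro: power_mono\<close>)
  also have "\<dots> = 450 * poly_bound"
    by (simp only: poly_bound_def power_add mult.assoc mult.commute[of "?N ^ 4"])
  finally show ?thesis .
qed

section \<open>Quality and cost of the search tree\<close>

text \<open>The ratio is promised only against minimum covers that agree with the decisions made so
  far; at the root this is every minimum cover.\<close>

definition good_answer :: "nat list \<Rightarrow> nat list \<Rightarrow> nat list \<Rightarrow> bool" where
  "good_answer ins outs S \<longleftrightarrow> distinct S \<and> kpath_cover k G (set S) \<and>
     (\<forall>S'. min_kpath_cover k G w S' \<longrightarrow> set ins \<inter> S' = {} \<longrightarrow> set outs \<subseteq> S' \<longrightarrow>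
        sum w (set S) \<le> (2 - 1 / \<rho>) * sum w S')"

lemma good_answer_length: "good_answer ins outs S \<Longrightarrow> length S \<le> length vn"
  by (auto simp: good_answer_def kpath_cover_def intro: length_le_n)

lemma good_answer_weight: "good_answer ins outs S \<Longrightarrow> listed_weight w vn S = sum w (set S)"
  using listed_weight_eq[OF vn(1)] vn(2) by (simp add: good_answer_def kpath_cover_def)

lemma find_frontier:
  assumes "find (frontier es vo ins outs) vn = Some v"
  shows "v \<in> verts G" "frontier es vo ins outs v"
  using assms vn(2) by (auto simp: find_Some_iff)

text \<open>At a leaf \<open>outs\<close> plays the role of \<open>F\<close>. The two covers
  compared are the old optimum together with \<open>outs\<close> and the answer of the solver, and
  \<open>reopt_ratio\<close> applies with \<open>f\<close> the weight of
  \<open>outs\<close>.\<close>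

lemma search_leaf:
  assumes ex: "explored ins outs" and leaf: "find (frontier es vo ins outs) vn = None"
  shows "\<exists>S. computes table A 9 (Cell (enc_verts ins) (Cell (enc_verts outs) ctx)) (enc_verts S)
    node_bound \<and> good_answer ins outs S"
proof -
  have no: "\<not> frontier es vo ins outs v" if "v \<in> verts G" for v
    using leaf that vn(2) by (auto simp: find_None_iff)
  define S1 where "S1 = filter (\<lambda>u. u \<notin> set outs) opt @ outs"
  have dist: "distinct outs" "distinct ins" and sub: "set outs \<subseteq> verts G" "set ins \<subseteq> verts G"
    using ex by (auto simp: explored_def)
  have S1: "distinct S1" "set S1 = old_opt I \<union> set outs"
    using opt dist by (auto simp: S1_def)
  have c1: "kpath_cover k G (set S1)"
    unfolding S1(2) by (rule leaf_cover[OF ex no])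
  obtain S2 where S2: "answer A (query outs) = enc_verts S2" "distinct S2" "kpath_cover k G (set S2)"
    "\<And>S'. kpath_cover k G S' \<Longrightarrow> set outs \<subseteq> S' \<Longrightarrow>
       sum w (set S2) \<le> sum w (set outs) + \<rho> * (sum w S' - sum w (set outs))"
    using query_answer[of outs] by blast
  have ans: "answer A (Cell (enc_weights (\<lambda>v. if v \<in> set outs then 0 else w v) vn) (enc_edges es))
      = enc_verts S2"
    and st: "steps A (Cell (enc_weights (\<lambda>v. if v \<in> set outs then 0 else w v) vn) (enc_edges es)) \<le> T G"
    using S2(1) query_time[of outs] by (simp_all add: query_def)
  define S where "S = (if listed_weight w vn S1 \<le> listed_weight w vn S2 then S1 else S2)"
  have len: "length S1 \<le> length vn" "length S2 \<le> length vn" "length ins \<le> length vn" "length outs \<le> length vn"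
    using S1(1) c1 S2(2,3) dist sub by (auto simp: kpath_cover_def intro!: length_le_n)
  have lw: "listed_weight w vn S1 = sum w (set S1)" "listed_weight w vn S2 = sum w (set S2)"
    using listed_weight_eq[OF vn(1)] vn(2) c1 S2(3) by (simp_all add: kpath_cover_def)
  have "sum w (set S) \<le> (2 - 1 / \<rho>) * sum w S'"
    if S': "min_kpath_cover k G w S'" "set outs \<subseteq> S'" for S'
  proof -
    have cov: "kpath_cover k G S'"
      using S'(1) by (simp add: min_kpath_cover_def)
    have "sum w (set S1) \<le> sum w (old_opt I) + sum w (set outs)"
    proof -
      have "sum w (set S1) + sum w (old_opt I \<inter> set outs) = sum w (old_opt I) + sum w (set outs)"
        \<comment> \<open>Finiteness of \<open>old_opt I\<close> comes from its listing
          \<open>opt\<close>.\<close>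
        unfolding S1(2) by (rule sum.union_inter) (use opt(2)[symmetric] in auto)
      moreover have "0 \<le> sum w (old_opt I \<inter> set outs)"
        using sub weight_nonneg by (intro sum_nonneg) auto
      ultimately show ?thesis by linarith
    qed
    then have "sum w (set S1) \<le> sum w S' + sum w (set outs)"
      using old_opt_weight[OF cov] by linarith
    then have "min (sum w (set S1)) (sum w (set S2)) \<le> (2 - 1 / \<rho>) * sum w S'"
      by (rule reopt_ratio[OF rho _ S2(4)[OF cov S'(2)]])
    then show ?thesis
      by (auto simp: S_def lw min_def split: if_splits)
  qed
  then have "good_answer ins outs S"
    using S1(1) c1 S2(2,3) by (simp add: good_answer_def S_def)
  moreover have "computes table A 9 (Cell (enc_verts ins) (Cell (enc_verts outs) ctx)) (enc_verts S) node_bound"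
  proof -
    note pick = computesD[OF pick_computes[of A vn ins outs "enc_verts vn" vo es
        "Cell (enc_weights w vn) (Cell (enc_verts opt) (unary k))"], unfolded leaf option.case]
    note union = computesD[OF union_computes[of A opt outs], folded S1_def]
    note zero = computesD[OF zero_computes[of A w vn outs]]
    note better = computesD[OF better_computes[of A w vn S1 S2], folded S_def]
    note bounds = pick(3)[THEN order_trans, OF pick_bound[OF len(3,4)]]
      union(3)[THEN order_trans, OF quadratic_bound[OF lengths(4) len(4)]]
      zero(3)[THEN order_trans, OF quadratic_bound[OF order_refl len(4)]]
      better(3)[THEN order_trans, OF better_bound[OF len(1,2)]] st poly_bound_ge(1)
    show ?thesis
      by (rule computesI)
        (use pick(1,2) union(1,2) zero(1,2) better(1,2) ans bounds in
          \<open>auto simp: search_body_def ctx_def node_bound_def\<close>)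
  qed
  ultimately show ?thesis by blast
qed

text \<open>Induction on the number \<open>d\<close> of decisions still possible; a binary tree of
  depth \<open>d\<close> has at most \<open>2 ^ Suc d - 1\<close> nodes.\<close>

lemma search_computes:
  assumes "is_kpath k G p" "explored ins outs" "depth \<le> d + (length ins + length outs)"
  shows "\<exists>S. computes table A 9 (Cell (enc_verts ins) (Cell (enc_verts outs) ctx)) (enc_verts S)
    (node_bound * (2 ^ Suc d - 1)) \<and> good_answer ins outs S"
  using assms(2,3)
proof (induction d arbitrary: ins outs)
  case 0
  \<comment> \<open>Moving a frontier vertex to \<open>outs\<close> would keep the invariant and
    exceed \<open>depth\<close>.\<close>
  have "find (frontier es vo ins outs) vn = None"
  proof (rule ccontr)
    assume "find (frontier es vo ins outs) vn \<noteq> None"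
    then obtain v where "find (frontier es vo ins outs) vn = Some v" by blast
    from find_frontier[OF this] have "explored ins (v # outs)"
      using explored_out[OF 0(1)] by blast
    from explored_depth[OF this assms(1)] show False
      using 0(2) by simp
  qed
  from search_leaf[OF 0(1) this] show ?case by simp
next
  case (Suc d)
  show ?case
  proof (cases "find (frontier es vo ins outs) vn")
    case None
    have le: "node_bound * 1 \<le> node_bound * (2 ^ Suc (Suc d) - 1)"
      by (rule mult_le_mono2) (cases "(2::nat) ^ d"; simp)
    obtain S where "computes table A 9 (Cell (enc_verts ins) (Cell (enc_verts outs) ctx)) (enc_verts S)
        node_bound" "good_answer ins outs S"
      using search_leaf[OF Suc.prems(1) None] by blast
    then show ?thesis
      using computes_mono[OF _ le[unfolded mult_1_right]] by blast
  next
    case (Some v)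
    note v = find_frontier[OF Some]
    define X where "X = node_bound * (2 ^ Suc d - 1)"
    have ex1: "explored ins (v # outs)"
      by (rule explored_out[OF Suc.prems(1) v(2,1)])
    obtain S1 where S1: "computes table A 9 (Cell (enc_verts ins) (Cell (enc_verts (v # outs)) ctx)) (enc_verts S1) X"
      "good_answer ins (v # outs) S1"
      using Suc.IH[OF ex1, folded X_def] Suc.prems(2) by auto
    have dist: "distinct outs" "distinct (v # ins)" and sub: "set outs \<subseteq> verts G" "set (v # ins) \<subseteq> verts G"
      using Suc.prems(1) v by (simp_all add: explored_def frontier_def)
    have len: "length (v # ins) \<le> length vn" "length outs \<le> length vn"
      by (rule length_le_n[OF dist(2) sub(2)], rule length_le_n[OF dist(1) sub(1)])
    have len': "length ins \<le> length vn"
      using len by simp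
    have bound: "node_bound + 2 * X = node_bound * (2 ^ Suc (Suc d) - 1)"
    proof -
      obtain z where z: "(2::nat) ^ Suc d = Suc z"
        by (metis not0_implies_Suc power_not_zero zero_neq_numeral)
      then have "(2::nat) ^ Suc (Suc d) = 2 * Suc z"
        by simp
      then show ?thesis
        unfolding X_def z by simp
    qed
    note pick = computesD[OF pick_computes[of A vn ins outs "enc_verts vn" vo es
        "Cell (enc_weights w vn) (Cell (enc_verts opt) (unary k))"], unfolded Some option.case]
    have sub_refl: "set (v # ins) \<subseteq> set (v # ins)" and k0: "length [] + k \<le> k"
      by simp_all
    note extend = computesD[OF extend_computes[OF sub_refl k0, of A es]]
    note r1 = computesD[OF S1(1)]
    note bounds = pick(3)[THEN order_trans, OF pick_bound[OF len' len(2)]]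
      extend(3)[THEN order_trans, OF extend_bound[OF len(1)]] poly_bound_ge(1)
    show ?thesis
    \<comment> \<open>If \<open>v\<close> completes a \<open>k\<close>-path with \<open>ins\<close>,
      every cover that avoids \<open>ins\<close> contains \<open>v\<close>, so only the branch with
      \<open>v\<close> in \<open>outs\<close> is searched.\<close>
    proof (cases "extends es (v # ins) k (v # ins) []")
      case True
      then obtain q where q: "is_kpath k G q" "set q \<subseteq> set (v # ins)"
        using extends_iff[OF sub(2)] by blast
      have "v \<in> S'" if "min_kpath_cover k G w S'" "set ins \<inter> S' = {}" for S'
      proof -
        have "set q \<inter> S' \<noteq> {}"
          using that(1) q(1) by (auto simp: min_kpath_cover_def kpath_cover_def)
        then show ?thesis
          using that(2) q(2) by auto
      qed
      then have "good_answer ins outs S1"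
        using S1(2) by (auto simp: good_answer_def)
      moreover have "computes table A 9 (Cell (enc_verts ins) (Cell (enc_verts outs) ctx)) (enc_verts S1)
          (node_bound + 2 * X)"
        by (rule computesI)
          (use pick(1,2) extend(1,2) True r1 bounds in
            \<open>auto simp: search_body_def ctx_def node_bound_def\<close>)
      ultimately show ?thesis
        unfolding bound by blast
    next
      case False
      then have "\<not> set q \<subseteq> set (v # ins)" if "is_kpath k G q" for q
        using extends_iff[OF sub(2)] that by blast
      then have ex2: "explored (v # ins) outs"
        using explored_in[OF Suc.prems(1) v(2,1)] by blast
      obtain S2 where S2: "computes table A 9 (Cell (enc_verts (v # ins)) (Cell (enc_verts outs) ctx)) (enc_verts S2) X"
        "good_answer (v # ins) outs S2"
        using Suc.IH[OF ex2, folded X_def] Suc.prems(2) by auto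
      define S where "S = (if listed_weight w vn S1 \<le> listed_weight w vn S2 then S1 else S2)"
      \<comment> \<open>A minimum cover contains \<open>v\<close> or not; the answer of the matching
        branch meets the ratio, and the lighter answer is no worse.\<close>
      have "sum w (set S) \<le> (2 - 1 / \<rho>) * sum w S'"
        if S': "min_kpath_cover k G w S'" "set ins \<inter> S' = {}" "set outs \<subseteq> S'" for S'
      proof (cases "v \<in> S'")
        case True
        then have "sum w (set S1) \<le> (2 - 1 / \<rho>) * sum w S'"
          using S1(2) S' by (simp add: good_answer_def)
        then show ?thesis
          by (auto simp: S_def good_answer_weight[OF S1(2)] good_answer_weight[OF S2(2)])
      next
        case False
        then have "sum w (set S2) \<le> (2 - 1 / \<rho>) * sum w S'"
          using S2(2) S' by (simp add: good_answer_def)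
        then show ?thesis
          by (auto simp: S_def good_answer_weight[OF S1(2)] good_answer_weight[OF S2(2)])
      qed
      then have "good_answer ins outs S"
        using S1(2) S2(2) by (simp add: good_answer_def S_def)
      moreover have "computes table A 9 (Cell (enc_verts ins) (Cell (enc_verts outs) ctx)) (enc_verts S)
          (node_bound + 2 * X)"
      proof -
        note better = computesD[OF better_computes[of A w vn S1 S2], folded S_def]
        note r2 = computesD[OF S2(1)]
        note bounds' = better(3)[THEN order_trans,
            OF better_bound[OF good_answer_length[OF S1(2)] good_answer_length[OF S2(2)]]]
        show ?thesis
          by (rule computesI)
            (use pick(1,2) extend(1,2) False r1 r2 better(1,2) bounds bounds' in
              \<open>auto simp: search_body_def ctx_def node_bound_def\<close>)
      qed
      ultimately show ?thesis
        unfolding bound by blast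
    qed
  qed
qed

text \<open>If there is no \<open>k\<close>-path, the empty cover has weight 0, which the ratio
  allows because \<open>2 - 1 / \<rho>\<close> and all weights are nonnegative. Otherwise
  \<open>search_computes\<close> is applied at the root with all of \<open>depth\<close>
  available.\<close>

lemma main_runs:
  assumes x: "x = Cell (Cell (enc_verts vo) eo) (Cell (Cell (enc_weights w vn) (enc_edges es)) (enc_verts opt))"
  shows "\<exists>t S. runs (table, main_expr k) A x (enc_verts S) t \<and> t \<le> 4 * node_bound * 2 ^ depth \<and>
    distinct S \<and> kpath_cover k G (set S) \<and>
    (\<forall>S'. min_kpath_cover k G w S' \<longrightarrow> sum w (set S) \<le> (2 - 1 / \<rho>) * sum w S')"
proof -
  have sub: "set vn \<subseteq> set vn" and k0: "length [] + k \<le> k"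
    by simp_all
  have vnG: "set vn \<subseteq> verts G"
    by (simp add: vn)
  note extend = computesD[OF extend_computes[OF sub k0, of A es]]
  note proj = computesD[OF proj_computes[of A w vn]]
  note bounds = extend(3)[THEN order_trans, OF extend_bound[OF order_refl]] proj(3) poly_bound_ge
  have runsI: "runs (table, main_expr k) A x y (cost_expr table A (main_expr k) [x])"
    if "safe_expr table A (main_expr k) [x]" "eval_expr table A (main_expr k) [x] = y" for y
    using safe_big_step[OF that(1)] that(2) by (simp add: runs_def)
  have pow: "node_bound * 1 \<le> node_bound * 2 ^ depth"
    by (intro mult_le_mono2) simp
  then have pow': "c \<le> 4 * node_bound * 2 ^ depth" if "c \<le> node_bound" for c
    using that unfolding mult.assoc by linarith
  show ?thesis
  proof (cases "extends es vn k vn []")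
    case False
    then have "\<not> is_kpath k G q" for q
      using extends_iff[OF vnG] by (auto simp: is_kpath_def vn)
    then have "kpath_cover k G (set [])"
      by (simp add: kpath_cover_def)
    moreover have "sum w (set []) \<le> (2 - 1 / \<rho>) * sum w S'" if "min_kpath_cover k G w S'" for S'
    proof -
      have "0 \<le> sum w S'"
        using that weight_nonneg by (intro sum_nonneg) (auto simp: min_kpath_cover_def kpath_cover_def)
      moreover have "0 \<le> 2 - 1 / \<rho>"
        using rho by (simp add: field_simps)
      ultimately show ?thesis by simp
    qed
    moreover have "safe_expr table A (main_expr k) [x]" "eval_expr table A (main_expr k) [x] = enc_verts []"
      using extend(1,2) proj(1,2) False by (simp_all add: main_expr_def x)
    moreover have "cost_expr table A (main_expr k) [x] \<le> node_bound"
      using extend(1,2) proj(1,2) False bounds by (auto simp: main_expr_def x node_bound_def)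
    ultimately show ?thesis
      using runsI[of "enc_verts []"] pow'
      by (intro exI[of _ "cost_expr table A (main_expr k) [x]"] exI[of _ "[]"]) auto
  next
    case True
    then obtain p where p: "is_kpath k G p"
      using extends_iff[OF vnG] by blast
    obtain S where S: "computes table A 9 (Cell (enc_verts []) (Cell (enc_verts []) ctx)) (enc_verts S)
        (node_bound * (2 ^ Suc depth - 1))" "good_answer [] [] S"
      using search_computes[OF p explored_Nil, of depth] by auto
    note search = computesD[OF S(1), unfolded ctx_def]
    have "node_bound * (2 ^ Suc depth - 1) \<le> node_bound * 2 ^ Suc depth"
      by (intro mult_le_mono2) simp
    also have "\<dots> = 2 * (node_bound * 2 ^ depth)"
      by simp
    finally have le: "node_bound * (2 ^ Suc depth - 1) \<le> 2 * (node_bound * 2 ^ depth)" .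
    have "safe_expr table A (main_expr k) [x]" "eval_expr table A (main_expr k) [x] = enc_verts S"
      using extend(1,2) proj(1,2) search(1,2) True by (simp_all add: main_expr_def x)
    moreover have "cost_expr table A (main_expr k) [x] \<le> 4 * node_bound * 2 ^ depth"
    proof -
      \<comment> \<open>The preliminary test fits into one \<open>node_bound\<close>, and the tree
        has fewer than \<open>2 * 2 ^ depth\<close> nodes.\<close>
      have "cost_expr table A (main_expr k) [x] \<le> node_bound + 2 * (node_bound * 2 ^ depth)"
        using extend(1,2) proj(1,2) True bounds order_trans[OF search(3) le]
        by (auto simp: main_expr_def x node_bound_def)
      also have "\<dots> \<le> 4 * node_bound * 2 ^ depth"
        using pow by simp
      finally show ?thesis .
    qed
    ultimately show ?thesis
      using runsI[of "enc_verts S"] S(2)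
      by (intro exI[of _ "cost_expr table A (main_expr k) [x]"] exI[of _ S]) (auto simp: good_answer_def)
  qed
qed

lemma node_bound_le: "node_bound \<le> 3001 * poly_bound * T G"
proof -
  have "3000 * poly_bound * 1 + 1 * T G \<le> 3000 * poly_bound * T G + poly_bound * T G"
    using T_pos poly_bound_ge(1) by (intro add_le_mono mult_le_mono) auto
  then show ?thesis
    by (simp add: node_bound_def)
qed

end

section \<open>Assembling ratio and running time\<close>

theorem theorem4:
  fixes k :: nat
  assumes "4 \<le> k"
  shows "\<exists>(P :: program) (d :: nat).
    \<forall>(\<rho> :: real) (A :: solver) (T :: graph \<Rightarrow> nat) (C :: insertion set).
      1 \<le> \<rho> \<and> approximation_algorithm k \<rho> A \<and> has_running_time A T \<and>
      (\<forall>I\<in>C. valid_insertion k I) \<and>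
      (\<lambda>I. real ((new_max_degree I + 1) * branching_bound k I))
        \<in> O[large_insertions C](\<lambda>I. ln (real (new_order I)))
      \<longrightarrow>
      (\<exists>time :: insertion \<Rightarrow> nat.
        (\<forall>I\<in>C. \<forall>x. encodes_insertion I x \<longrightarrow>
          (\<exists>y t S. runs P A x y t \<and> t \<le> time I \<and> encodes_set S y \<and>
            kpath_cover k (new_graph I) S \<and>
            (\<forall>S'. min_kpath_cover k (new_graph I) (weight I) S' \<longrightarrow>
              sum (weight I) S \<le> (2 - 1 / \<rho>) * sum (weight I) S'))) \<and>
        (\<lambda>I. real (time I)) \<in> O[large_insertions C](\<lambda>I.
          real (new_order I) ^ d *
          2 ^ (k * (new_max_degree I + 1) * branching_bound k I) *
          real (T (new_graph I))))"
proof (rule exI[of _ "(table, main_expr k)"], rule exI[of _ "k + 4"], intro allI impI, elim conjE)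
  fix \<rho> :: real and A :: solver and T :: "graph \<Rightarrow> nat" and C :: "insertion set"
  assume hyps: "1 \<le> \<rho>" "approximation_algorithm k \<rho> A" "has_running_time A T"
    "\<forall>I\<in>C. valid_insertion k I"
  \<comment> \<open>The degree of \<open>poly_bound\<close>.\<close>
  let ?d = "k + 4"
  define D where "D I = k * (new_max_degree I + 1) * branching_bound k I" for I
  \<comment> \<open>The factor 4 comes from \<open>main_runs\<close> and 3001 from
    \<open>node_bound_le\<close>. The length of the vertex listing is replaced by
    \<open>new_order I\<close>, so that \<open>time\<close> depends on the instance and not on its
    encoding.\<close>
  define time where
    "time I = 4 * (3001 * ((k + 1) * (new_order I + 2) ^ ?d) * T (new_graph I)) * 2 ^ D I" for I
  show "\<exists>time :: insertion \<Rightarrow> nat.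
        (\<forall>I\<in>C. \<forall>x. encodes_insertion I x \<longrightarrow>
          (\<exists>y t S. runs (table, main_expr k) A x y t \<and> t \<le> time I \<and> encodes_set S y \<and>
            kpath_cover k (new_graph I) S \<and>
            (\<forall>S'. min_kpath_cover k (new_graph I) (weight I) S' \<longrightarrow>
              sum (weight I) S \<le> (2 - 1 / \<rho>) * sum (weight I) S'))) \<and>
        (\<lambda>I. real (time I)) \<in> O[large_insertions C](\<lambda>I.
          real (new_order I) ^ ?d *
          2 ^ (k * (new_max_degree I + 1) * branching_bound k I) *
          real (T (new_graph I)))"
  proof (intro exI[of _ time] conjI ballI allI impI)
    fix I x assume I: "I \<in> C" and x: "encodes_insertion I x"
    obtain a b c where abc: "encodes_graph (old_graph I) a"
      "encodes_weighted_graph (new_graph I) (weight I) b" "encodes_set (old_opt I) c"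
      "x = Cell a (Cell b c)"
      using x unfolding encodes_insertion_def by blast
    obtain vo eo where a: "distinct vo" "set vo = verts (old_graph I)" "a = Cell (enc_verts vo) eo"
      using abc(1) unfolding encodes_graph_def encodes_set_def enc_verts_def by blast
    obtain vn es where b: "distinct vn" "set vn = verts (new_graph I)"
      "distinct (map (\<lambda>(u, v). {u, v}) es)" "(\<lambda>(u, v). {u, v}) ` set es = edges (new_graph I)"
      "b = Cell (enc_weights (weight I) vn) (enc_edges es)"
      using abc(2) unfolding encodes_weighted_graph_def encodes_edges_def enc_weights_def enc_edges_def
      by blast
    obtain opt where c: "distinct opt" "set opt = old_opt I" "c = enc_verts opt"
      using abc(3) unfolding encodes_set_def enc_verts_def by blast
    interpret reoptimization k \<rho> A T I vn vo opt es
      using assms hyps I a b c by unfold_locales auto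
    obtain t S where S: "runs (table, main_expr k) A x (enc_verts S) t"
      "t \<le> 4 * node_bound * 2 ^ depth" "distinct S" "kpath_cover k (new_graph I) (set S)"
      "\<forall>S'. min_kpath_cover k (new_graph I) (weight I) S' \<longrightarrow>
        sum (weight I) (set S) \<le> (2 - 1 / \<rho>) * sum (weight I) S'"
      using main_runs[of x eo] abc(4) a(3) b(5) c(3) by blast
    have "t \<le> 4 * (3001 * poly_bound * T (new_graph I)) * 2 ^ depth"
      using S(2) mult_le_mono1[OF mult_le_mono2[OF node_bound_le, of 4], of "2 ^ depth"] by linarith
    also have "\<dots> = time I"
      unfolding time_def D_def depth_def poly_bound_def new_order_def lengths(1) ..
    finally have "t \<le> time I" .
    moreover have "encodes_set (set S) (enc_verts S)"
      using S(3) unfolding encodes_set_def enc_verts_def by blast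
    ultimately show "\<exists>y t S. runs (table, main_expr k) A x y t \<and> t \<le> time I \<and> encodes_set S y \<and>
        kpath_cover k (new_graph I) S \<and> (\<forall>S'. min_kpath_cover k (new_graph I) (weight I) S' \<longrightarrow>
          sum (weight I) S \<le> (2 - 1 / \<rho>) * sum (weight I) S')"
      using S(1,4,5) by blast
  next
    \<comment> \<open>Here \<open>12004 = 4 * 3001\<close>, and the power of 2 pays for
      \<open>n + 2 \<le> 2 * n\<close>, valid once the order \<open>n\<close> is at least 2.\<close>
    let ?c = "12004 * (real k + 1) * 2 ^ ?d"
    have "eventually (\<lambda>I. 2 \<le> new_order I) (large_insertions C)"
      unfolding large_insertions_def
      by (rule filter_leD[OF inf_le1]) (rule eventually_filtercomapI[OF eventually_ge_at_top])
    then have "eventually (\<lambda>I. norm (real (time I)) \<le> ?c * norm (real (new_order I) ^ ?d *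
          2 ^ D I * real (T (new_graph I)))) (large_insertions C)"
    proof (rule eventually_mono)
      fix I assume n: "2 \<le> new_order I"
      have "(real (new_order I) + 2) ^ ?d \<le> (2 * real (new_order I)) ^ ?d"
        using n by (intro power_mono) auto
      then have "12004 * (real k + 1) * (real (new_order I) + 2) ^ ?d * (2 ^ D I * real (T (new_graph I)))
        \<le> 12004 * (real k + 1) * (2 * real (new_order I)) ^ ?d * (2 ^ D I * real (T (new_graph I)))"
        by (intro mult_right_mono mult_left_mono) auto
      then show "norm (real (time I)) \<le> ?c * norm (real (new_order I) ^ ?d *
          2 ^ D I * real (T (new_graph I)))"
        by (simp add: time_def power_mult_distrib algebra_simps)
    qed
    then show "(\<lambda>I. real (time I)) \<in> O[large_insertions C](\<lambda>I. real (new_order I) ^ ?d *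
          2 ^ (k * (new_max_degree I + 1) * branching_bound k I) * real (T (new_graph I)))"
      unfolding D_def by (rule bigoI)
  qed
qed

end
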